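(* Let $f(u)\ge 0$ be locally Lipschitz and let $u$ be a non-constant solution of $$\Delta u+f(u)=0\ \text{ in }\Omega,\qquad u=0\ \text{ on }\partial\Omega .$$ (1) Suppose that $\Omega\subset\mathbb{R}^2$ is an exterior petal-like domain whose exterior boundary $\gamma_E$ is an ellipse, where the radius of the interior boundary $\gamma_I$ is $a$ and the lengths of the semi-axes of $\gamma_E$ in the $x$- and $y$-directions are $b_1$ and $b_2$ respectively, the common center being the origin. Then all critical points of $u$ are located within $$\Big\{\Big(-\frac{a+b_1}{2},\frac{a+b_1}{2}\Big)\times\Big(-\frac{a+b_2}{2},\frac{a+b_2}{2}\Big)\Big\}\cap\Big\{\Omega\setminus\big\{(x,y):a<\sqrt{x^2+y^2}\le\sqrt{ac}\big\}\Big\},$$ where $c$ is the radius of the inscribed circle of the domain $\Omega_{\gamma_E}$ bounded by $\gamma_E$. (2) Suppose that $\Omega\subset\mathbb{R}^2$ is an eccentric circle annular domain, where the interior boundary $\gamma_I$ is the circle of radius $r$ centered at $(a,0)$ with $a>0$, and the exterior boundary $\gamma_E$ is the circle of radius $R$ centered at $(0,0)$, with $a+r<R$. Then all critical points of $u$ are located within $$\Big\{\Big(\frac{-R+a-r}{2},\frac{a+r+R}{2}\Big)\times(-R,R)\Big\}\cap\Big\{\Omega\setminus\big\{(x,y):r<\sqrt{(x-a)^2+y^2}\le\sqrt{r(R-a)}\big\}\Big\}.$$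
   Context: The function $f:\mathbb{R}\to\mathbb{R}$ satisfies $f\ge 0$. Solutions are understood in the classical sense. A critical point of $u$ is a point of $\Omega$ at which $\nabla u=0$. Exterior petal-like domain whose exterior boundary is an ellipse: the domain between an exterior boundary $\gamma_E$, a non-circular ellipse, and an interior boundary $\gamma_I$, a circle lying inside $\gamma_E$ whose center coincides with the center of the ellipse. The eccentric circle annular domain is the domain between the circles $\gamma_I$ and $\gamma_E$ described in the claim. *)

theory Defs
  imports "HOL-Analysis.Analysis"
begin

definition partial_deriv ::
    "'a::euclidean_space \<Rightarrow> ('a \<Rightarrow> real) \<Rightarrow> 'a \<Rightarrow> real" where
  "partial_deriv i u p = frechet_derivative u (at p) i"

text \<open>Intended for open sets only: all derivatives are taken in the whole space.\<close>

definition C2_on :: "'a::euclidean_space set \<Rightarrow> ('a \<Rightarrow> real) \<Rightarrow> bool" where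
  "C2_on S u \<longleftrightarrow>
     (\<forall>p\<in>S. u differentiable (at p)) \<and>
     (\<forall>i\<in>Basis. \<forall>p\<in>S. partial_deriv i u differentiable (at p)) \<and>
     (\<forall>i\<in>Basis. \<forall>j\<in>Basis. continuous_on S (partial_deriv j (partial_deriv i u)))"

definition laplacian :: "('a::euclidean_space \<Rightarrow> real) \<Rightarrow> 'a \<Rightarrow> real" where
  "laplacian u p = (\<Sum>i\<in>Basis. partial_deriv i (partial_deriv i u) p)"

definition locally_lipschitz :: "(real \<Rightarrow> real) \<Rightarrow> bool" where
  "locally_lipschitz f \<longleftrightarrow> (\<forall>s. \<exists>e>0. \<exists>L. L-lipschitz_on (ball s e) f)"

text \<open>
  Classical solutions of the semilinear Dirichlet problem: twice continuously differentiable
  in the domain and continuous up to the boundary. The values of \<open>u\<close> outside the closure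
  of \<open>\<Omega>\<close> are irrelevant.
\<close>

definition classical_solution ::
    "'a::euclidean_space set \<Rightarrow> (real \<Rightarrow> real) \<Rightarrow> ('a \<Rightarrow> real) \<Rightarrow> bool" where
  "classical_solution \<Omega> f u \<longleftrightarrow>
     C2_on \<Omega> u \<and> continuous_on (closure \<Omega>) u \<and>
     (\<forall>p\<in>\<Omega>. laplacian u p + f (u p) = 0) \<and>
     (\<forall>p\<in>frontier \<Omega>. u p = 0)"

definition critical_points :: "'a::euclidean_space set \<Rightarrow> ('a \<Rightarrow> real) \<Rightarrow> 'a set" where
  "critical_points \<Omega> u = {p \<in> \<Omega>. GDERIV u p :> 0}"

text \<open>
  Radius of an inscribed (largest contained) circle; meaningful for nonempty bounded open sets,
  for which the set below is nonempty and bounded above.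
\<close>

definition inradius :: "'a::euclidean_space set \<Rightarrow> real" where
  "inradius D = Sup {\<rho>. 0 < \<rho> \<and> (\<exists>p. ball p \<rho> \<subseteq> D)}"

definition ellipse_interior :: "real \<Rightarrow> real \<Rightarrow> (real \<times> real) set" where
  "ellipse_interior b1 b2 = {(x, y). (x / b1)\<^sup>2 + (y / b2)\<^sup>2 < 1}"

text \<open>
  \<open>\<Omega>\<close> lies between the circle of radius \<open>a\<close> and the non-circular ellipse with semi-axes
  \<open>b1\<close>, \<open>b2\<close>, both centered at the origin.
\<close>

definition elliptic_exterior_petal_domain ::
    "real \<Rightarrow> real \<Rightarrow> real \<Rightarrow> (real \<times> real) set \<Rightarrow> bool" where
  "elliptic_exterior_petal_domain a b1 b2 \<Omega> \<longleftrightarrow>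
     0 < a \<and> 0 < b1 \<and> 0 < b2 \<and> b1 \<noteq> b2 \<and>
     sphere (0, 0) a \<subseteq> ellipse_interior b1 b2 \<and>
     \<Omega> = ellipse_interior b1 b2 - cball (0, 0) a"

definition eccentric_annular_domain ::
    "real \<Rightarrow> real \<Rightarrow> real \<Rightarrow> (real \<times> real) set \<Rightarrow> bool" where
  "eccentric_annular_domain a r R \<Omega> \<longleftrightarrow>
     0 < a \<and> 0 < r \<and> a + r < R \<and>
     \<Omega> = ball (0, 0) R - cball (a, 0) r"

end

(* The proof uses moving planes. The domain is wide enough on the far side of the hole that caps
   of its outer boundary can be reflected in vertical lines without meeting the hole, down to the
   line halfway between the hole and the outer boundary. Comparing u with its reflection by the
   maximum principle shows that u strictly decreases across each such line, so no critical point
   lies on it. The other directions follow by symmetry. Near the hole the same argument is run in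
   logarithmic polar coordinates about its centre, where inversions become reflections: there the
   equation reads Laplace(U) + exp (-2 t) f(U) = 0, and f >= 0 makes the weight act in the right
   direction.

   Solutions are only continuous up to the boundary, so the continuation in the position of the line
   is arranged as follows: the reflected function exceeds u by a positive amount on the compact part
   of the cap away from the line, and a thin strip next to the line is covered by the maximum
   principle for narrow domains. *)

theory Submission
  imports Defs
begin

subsection \<open>Laplacians and maximum principles in the plane\<close>

text \<open>The constants mark the positions at which the far end of a cap reaches the hole: the
  line midway between the two boundaries, and the circle of radius sqrt (r m), whose inversion
  exchanges the circle of radius r around the hole with the largest concentric circle, of radius m,
  whose open disc fits inside the outer boundary. It is taken from one boundary point with u = 0
  whose mirror image has u > 0, and the strong maximum principle spreads it over the connected cap.
  For the inversion such a point is found because the circle of radius m meets the domain: this is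
  where b1 \<noteq> b2 and a > 0 enter. Lipschitz continuity of f turns the comparison into a linear
  inequality, Laplace(w) \<le> M |w|, and u > 0 follows from Laplace(u) = - f(u) \<le> 0. Hopf's
  lemma is applied only at interior points of the domain, which fits the lack of derivatives at the
  boundary.\<close>

definition second_deriv :: "(real \<Rightarrow> real) \<Rightarrow> real \<Rightarrow> real \<Rightarrow> bool" where
  "second_deriv h x D \<longleftrightarrow>
     (\<exists>h'. (\<forall>\<^sub>F s in nhds x. (h has_real_derivative h' s) (at s)) \<and>
       (h' has_real_derivative D) (at x))"

lemma second_derivI:
  assumes "open S" "x \<in> S" "\<And>s. s \<in> S \<Longrightarrow> (h has_real_derivative h' s) (at s)"
    and "(h' has_real_derivative D) (at x)"
  shows "second_deriv h x D"
  unfolding second_deriv_def using assms by (auto simp: eventually_nhds)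

lemma second_deriv_diff:
  assumes "second_deriv h x D" "second_deriv k x E"
  shows "second_deriv (\<lambda>s. h s - k s) x (D - E)"
proof -
  from assms obtain h' k'
    where ev: "\<forall>\<^sub>F s in nhds x. (h has_real_derivative h' s) (at s)"
      "\<forall>\<^sub>F s in nhds x. (k has_real_derivative k' s) (at s)"
      and D: "(h' has_real_derivative D) (at x)" "(k' has_real_derivative E) (at x)"
    unfolding second_deriv_def by auto
  have "\<forall>\<^sub>F s in nhds x. ((\<lambda>s. h s - k s) has_real_derivative (h' s - k' s)) (at s)"
    using ev by eventually_elim (rule DERIV_diff)
  then show ?thesis
    unfolding second_deriv_def using DERIV_diff[OF D] by (intro exI[of _ "\<lambda>s. h' s - k' s"]) auto
qed

lemma second_deriv_reflect:
  assumes "second_deriv h (c - x) D"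
  shows "second_deriv (\<lambda>s. h (c - s)) x D"
proof -
  from assms obtain h'
    where ev: "\<forall>\<^sub>F s in nhds (c - x). (h has_real_derivative h' s) (at s)"
      and D: "(h' has_real_derivative D) (at (c - x))"
    unfolding second_deriv_def by auto
  have "((\<lambda>s. c - s) \<longlongrightarrow> c - x) (nhds x)"
    by (intro tendsto_intros filterlim_ident)
  then have "\<forall>\<^sub>F s in nhds x. (h has_real_derivative h' (c - s)) (at (c - s))"
    by (rule eventually_compose_filterlim[OF ev])
  then have "\<forall>\<^sub>F s in nhds x. ((\<lambda>s. h (c - s)) has_real_derivative - h' (c - s)) (at s)"
  proof eventually_elim
    case (elim s)
    have "((\<lambda>s. c - s) has_real_derivative - 1) (at s)"
      by (auto intro!: derivative_eq_intros)
    from DERIV_chain2[OF elim this] show ?case by simp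
  qed
  moreover have "((\<lambda>s. - h' (c - s)) has_real_derivative D) (at x)"
  proof -
    have "((\<lambda>s. c - s) has_real_derivative - 1) (at x)"
      by (auto intro!: derivative_eq_intros)
    from DERIV_minus[OF DERIV_chain2[OF D this]] show ?thesis by simp
  qed
  ultimately show ?thesis
    unfolding second_deriv_def by (intro exI[of _ "\<lambda>s. - h' (c - s)"]) auto
qed

text \<open>If \<open>D < 0\<close>, then \<open>h'\<close> falls below \<open>h' x = 0\<close>
  immediately to the right of \<open>x\<close>, and the mean value theorem produces a smaller value
  of \<open>h\<close> there.\<close>

lemma second_deriv_local_min:
  assumes "second_deriv h x D" and "\<forall>\<^sub>F s in nhds x. h x \<le> h s"
  shows "0 \<le> D"
proof (rule ccontr)
  assume "\<not> 0 \<le> D"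
  then have "D < 0" by simp
  from assms(1) obtain h'
    where ev: "\<forall>\<^sub>F s in nhds x. (h has_real_derivative h' s) (at s)"
      and D: "(h' has_real_derivative D) (at x)"
    unfolding second_deriv_def by auto
  from eventually_conj[OF ev assms(2)] obtain d where "d > 0"
    and d: "\<And>s. dist s x < d \<Longrightarrow> (h has_real_derivative h' s) (at s) \<and> h x \<le> h s"
    unfolding eventually_nhds_metric by blast
  have "h' x = 0"
    by (rule DERIV_local_min[of h "h' x" x d]) (use d \<open>d > 0\<close> in \<open>auto simp: dist_real_def\<close>)
  obtain e where "e > 0" and e: "\<And>k. 0 < k \<Longrightarrow> k < e \<Longrightarrow> h' (x + k) < h' x"
    using DERIV_neg_dec_right[OF D \<open>D < 0\<close>] by blast
  define s where "s = x + min d e / 2"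
  have s: "x < s" "s < x + d" "s < x + e"
    unfolding s_def using \<open>d > 0\<close> \<open>e > 0\<close> by auto
  obtain z where z: "x < z" "z < s" "h s - h x = (s - x) * h' z"
    using MVT2[of x s h h'] s d by (force simp: dist_real_def)
  have "h' z < 0"
    using e[of "z - x"] z s \<open>h' x = 0\<close> by simp
  then have "h s < h x"
    using z s by (metis diff_gt_0_iff_gt less_iff_diff_less_0 mult_pos_neg)
  then show False using d[of s] s by (simp add: dist_real_def)
qed

text \<open>Derivatives are only required along the two coordinate lines through \<open>p\<close>: the second
  derivative test at a minimum needs no more, and compositions become one-variable computations.\<close>

definition has_laplacian :: "(real \<times> real \<Rightarrow> real) \<Rightarrow> real \<times> real \<Rightarrow> real \<Rightarrow> bool" where
  "has_laplacian w p L \<longleftrightarrow>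
     (\<exists>D E. second_deriv (\<lambda>s. w (s, snd p)) (fst p) D \<and>
        second_deriv (\<lambda>s. w (fst p, s)) (snd p) E \<and> L = D + E)"

lemma has_laplacian_diff:
  assumes "has_laplacian v p L" "has_laplacian w p M"
  shows "has_laplacian (\<lambda>q. v q - w q) p (L - M)"
proof -
  from assms obtain D E D' E'
    where *: "second_deriv (\<lambda>s. v (s, snd p)) (fst p) D" "second_deriv (\<lambda>s. v (fst p, s)) (snd p) E"
      "second_deriv (\<lambda>s. w (s, snd p)) (fst p) D'" "second_deriv (\<lambda>s. w (fst p, s)) (snd p) E'"
      "L = D + E" "M = D' + E'"
    unfolding has_laplacian_def by blast
  show ?thesis
    unfolding has_laplacian_def
    by (rule exI[of _ "D - D'"], rule exI[of _ "E - E'"]) (use * in \<open>auto intro: second_deriv_diff\<close>)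
qed

lemma has_laplacian_reflect:
  assumes "has_laplacian u (c - fst p, snd p) L"
  shows "has_laplacian (\<lambda>q. u (c - fst q, snd q)) p L"
proof -
  from assms obtain D E
    where *: "second_deriv (\<lambda>s. u (s, snd p)) (c - fst p) D"
      "second_deriv (\<lambda>s. u (c - fst p, s)) (snd p) E" "L = D + E"
    unfolding has_laplacian_def by auto
  show ?thesis
    unfolding has_laplacian_def using * second_deriv_reflect[OF *(1)] by auto
qed

lemma has_laplacian_swap:
  assumes "has_laplacian u (snd p, fst p) L"
  shows "has_laplacian (\<lambda>q. u (snd q, fst q)) p L"
  using assms unfolding has_laplacian_def by (auto simp: add.commute)

lemma has_laplacian_local_min:
  assumes "has_laplacian w p L" and "\<forall>\<^sub>F q in nhds p. w p \<le> w q"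
  shows "0 \<le> L"
proof -
  from assms(1) obtain D E
    where *: "second_deriv (\<lambda>s. w (s, snd p)) (fst p) D"
      "second_deriv (\<lambda>s. w (fst p, s)) (snd p) E" "L = D + E"
    unfolding has_laplacian_def by auto
  have "((\<lambda>s. (s, snd p)) \<longlongrightarrow> (fst p, snd p)) (nhds (fst p))"
    "((\<lambda>s. (fst p, s)) \<longlongrightarrow> (fst p, snd p)) (nhds (snd p))"
    by (intro tendsto_intros filterlim_ident)+
  then have ev: "\<forall>\<^sub>F s in nhds (fst p). w p \<le> w (s, snd p)" "\<forall>\<^sub>F s in nhds (snd p). w p \<le> w (fst p, s)"
    by (auto intro: eventually_compose_filterlim[OF assms(2)])
  have "0 \<le> D" "0 \<le> E"
    using second_deriv_local_min[OF *(1)] second_deriv_local_min[OF *(2)] ev by simp_all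
  then show ?thesis using * by simp
qed

section \<open>Barriers, Hopf's lemma and the strong maximum principle\<close>

lemma has_laplacian_strip_barrier:
  "has_laplacian (\<lambda>q. m * (2 - k * (fst q - c)\<^sup>2)) p (- 2 * k * m)"
  unfolding has_laplacian_def
proof (intro exI conjI)
  show "second_deriv (\<lambda>s. m * (2 - k * (fst (s, snd p) - c)\<^sup>2)) (fst p) (- 2 * k * m)"
    by (rule second_derivI[where S = UNIV and h' = "\<lambda>s. - 2 * k * m * (s - c)"])
      (auto intro!: derivative_eq_intros simp: algebra_simps)
  show "second_deriv (\<lambda>s. m * (2 - k * (fst (fst p, s) - c)\<^sup>2)) (snd p) 0"
    by (rule second_derivI[where S = UNIV and h' = "\<lambda>s. 0"])
      (auto intro!: derivative_eq_intros)
qed simp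

text \<open>Hopf's Gaussian barrier, constant on circles about \<open>c\<close>. Each of the two
  coordinates contributes 2k to the term 4k; the quadratic term wins away from \<open>c\<close> once
  \<open>k\<close> is large.\<close>

lemma has_laplacian_hopf_barrier:
  "has_laplacian (\<lambda>q. m * (exp (- k * (dist q c)\<^sup>2) - d)) p
     (m * (4 * k\<^sup>2 * (dist p c)\<^sup>2 - 4 * k) * exp (- k * (dist p c)\<^sup>2))"
proof -
  have *: "second_deriv (\<lambda>s. m * (exp (- k * ((s - a)\<^sup>2 + b)) - d)) x
     (m * (4 * k\<^sup>2 * (x - a)\<^sup>2 - 2 * k) * exp (- k * ((x - a)\<^sup>2 + b)))" for x a b
    by (rule second_derivI[where S = UNIV and h' = "\<lambda>s. - 2 * k * m * (s - a) * exp (- k * ((s - a)\<^sup>2 + b))"])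
      (auto intro!: derivative_eq_intros simp: algebra_simps power2_eq_square)
  obtain p1 p2 c1 c2 where pc: "p = (p1, p2)" "c = (c1, c2)" by fastforce
  have dist: "(dist (x, y) (c1, c2))\<^sup>2 = (x - c1)\<^sup>2 + (y - c2)\<^sup>2" for x y
    by (simp add: dist_prod_def dist_real_def)
  show ?thesis
    unfolding has_laplacian_def pc fst_conv snd_conv dist
    by (intro exI conjI, rule *, subst add.commute, rule *) (simp add: algebra_simps)
qed

text \<open>Hopf's lemma without derivatives: on the outer annulus of the ball, \<open>w\<close>
  dominates a Gaussian barrier vanishing on the bounding circle, hence grows at least linearly in
  the distance to that circle. Stated as a lower bound, it serves both at a touching point of the
  zero set and at a point of the mirror line.\<close>

lemma hopf_barrier:
  fixes q :: "real \<times> real"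
  assumes "0 < d" and cont: "continuous_on (cball q d) w"
    and lap: "\<And>p. p \<in> ball q d \<Longrightarrow> \<exists>L. has_laplacian w p L \<and> L \<le> M * w p"
    and "0 \<le> M"
    and pos: "\<And>p. p \<in> ball q d \<Longrightarrow> 0 < w p"
    and nonneg: "\<And>p. p \<in> cball q d \<Longrightarrow> 0 \<le> w p"
  shows "\<exists>e>0. \<forall>p\<in>cball q d. d / 2 \<le> dist p q \<longrightarrow> e * (d\<^sup>2 - (dist p q)\<^sup>2) \<le> w p"
proof -
  have "compact (cball q (d/2))" "cball q (d/2) \<noteq> {}" "continuous_on (cball q (d/2)) w"
    using \<open>0 < d\<close> by (auto intro: continuous_on_subset[OF cont])
  from continuous_attains_inf[OF this] obtain p0
    where p0: "p0 \<in> cball q (d/2)" "\<And>p. p \<in> cball q (d/2) \<Longrightarrow> w p0 \<le> w p" by blast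
  define m where "m = w p0"
  have "0 < m" unfolding m_def using p0(1) \<open>0 < d\<close> by (intro pos) auto
  \<comment> \<open>Chosen so that k d^2 \<ge> M + 5 and k \<ge> 1. Then k^2 d^2 - 4k \<ge> k (M +
    1) > M, and on the annulus, where the distance to \<open>q\<close> is at least d/2, the factor 4
    k^2 dist^2 - 4k in the Laplacian of the barrier exceeds \<open>M\<close>.\<close>
  define k where "k = (4 + M + 1) / d\<^sup>2 + 1 + M"
  have "0 < k" unfolding k_def using \<open>0 < d\<close> \<open>0 \<le> M\<close> by (intro add_pos_nonneg) auto
  have k_large: "M < k\<^sup>2 * d\<^sup>2 - 4 * k"
  proof -
    have "k * d\<^sup>2 \<ge> 4 + M + 1"
      unfolding k_def using \<open>0 < d\<close> \<open>0 \<le> M\<close> by (simp add: field_simps)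
    then have "k * (k * d\<^sup>2) \<ge> k * (4 + M + 1)"
      using \<open>0 < k\<close> by (intro mult_left_mono) auto
    moreover have "k \<ge> 1" unfolding k_def using \<open>0 \<le> M\<close> by simp
    then have "k * M \<ge> 1 * M" using \<open>0 \<le> M\<close> by (intro mult_right_mono) auto
    ultimately show ?thesis using \<open>0 < k\<close> by (simp add: algebra_simps power2_eq_square)
  qed
  define h where "h p = m * (exp (- k * (dist p q)\<^sup>2) - exp (- k * d\<^sup>2))" for p
  define A where "A = cball q d - ball q (d/2)"
  have "compact A" unfolding A_def by (intro compact_diff) auto
  have "q + (d, 0) \<in> A" using \<open>0 < d\<close> by (auto simp: A_def dist_norm norm_Pair)
  then have "A \<noteq> {}" by auto
  have "continuous_on A (\<lambda>p. w p - h p)"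
    unfolding h_def by (intro continuous_intros continuous_on_subset[OF cont]) (auto simp: A_def)
  from continuous_attains_inf[OF \<open>compact A\<close> \<open>A \<noteq> {}\<close> this] obtain p1
    where p1: "p1 \<in> A" "\<And>p. p \<in> A \<Longrightarrow> w p1 - h p1 \<le> w p - h p" by blast
  have "0 \<le> w p1 - h p1"
  proof (rule ccontr)
    assume neg: "\<not> 0 \<le> w p1 - h p1"
    have "dist p1 q \<noteq> d"
    proof
      assume "dist p1 q = d"
      then have "h p1 = 0" by (simp add: h_def)
      then show False using nonneg[of p1] p1(1) neg by (auto simp: A_def)
    qed
    moreover have "dist p1 q \<noteq> d/2"
    proof
      assume *: "dist p1 q = d/2"
      have "exp (- k * (dist p1 q)\<^sup>2) \<le> 1" using \<open>0 < k\<close> by simp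
      then have "exp (- k * (dist p1 q)\<^sup>2) - exp (- k * d\<^sup>2) \<le> 1"
        by (smt (verit) exp_gt_zero)
      then have "h p1 \<le> m * 1"
        unfolding h_def using \<open>0 < m\<close> by (intro mult_left_mono) auto
      also have "\<dots> \<le> w p1" unfolding m_def using * p0(2)[of p1] by (simp add: dist_commute)
      finally show False using neg by simp
    qed
    ultimately have r: "d/2 < dist p1 q" "dist p1 q < d"
      using p1(1) by (auto simp: A_def dist_commute)
    obtain L where L: "has_laplacian w p1 L" "L \<le> M * w p1"
      using lap[of p1] r by (auto simp: dist_commute)
    define E where "E = exp (- k * (dist p1 q)\<^sup>2)"
    have lap_diff: "has_laplacian (\<lambda>p. w p - h p) p1 (L - m * (4 * k\<^sup>2 * (dist p1 q)\<^sup>2 - 4 * k) * E)"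
      unfolding h_def E_def by (intro has_laplacian_diff L has_laplacian_hopf_barrier)
    have "open (ball q d - cball q (d/2))" "p1 \<in> ball q d - cball q (d/2)"
      using r by (auto simp: dist_commute)
    then have "\<forall>\<^sub>F p in nhds p1. w p1 - h p1 \<le> w p - h p"
      unfolding eventually_nhds
      by (intro exI[of _ "ball q d - cball q (d/2)"]) (auto intro!: p1 simp: A_def)
    \<comment> \<open>Three facts collide: minimality bounds the Laplacian of \<open>h\<close> at
      \<open>p1\<close> by M w, the choice of \<open>k\<close> makes it larger than M m E, and
      negativity gives w < h \<le> m E at \<open>p1\<close>.\<close>
    from has_laplacian_local_min[OF lap_diff this]
    have "m * (4 * k\<^sup>2 * (dist p1 q)\<^sup>2 - 4 * k) * E \<le> M * w p1" using L by simp
    moreover have "M * (m * E) < m * (4 * k\<^sup>2 * (dist p1 q)\<^sup>2 - 4 * k) * E"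
    proof -
      have "(d/2)\<^sup>2 \<le> (dist p1 q)\<^sup>2" using r \<open>0 < d\<close> by (intro power_mono) auto
      then have "k\<^sup>2 * d\<^sup>2 \<le> 4 * k\<^sup>2 * (dist p1 q)\<^sup>2"
        using mult_left_mono[of "(d/2)\<^sup>2" "(dist p1 q)\<^sup>2" "4 * k\<^sup>2"] by (simp add: power_divide)
      then have "M < 4 * k\<^sup>2 * (dist p1 q)\<^sup>2 - 4 * k" using k_large by simp
      moreover have "0 < m * E" using \<open>0 < m\<close> by (simp add: E_def)
      ultimately have "M * (m * E) < (4 * k\<^sup>2 * (dist p1 q)\<^sup>2 - 4 * k) * (m * E)"
        by (rule mult_strict_right_mono)
      then show ?thesis by (simp add: algebra_simps)
    qed
    moreover have "h p1 \<le> m * E"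
      unfolding h_def E_def using \<open>0 < m\<close> by (simp add: algebra_simps)
    then have "M * w p1 \<le> M * (m * E)"
      using neg \<open>0 \<le> M\<close> by (intro mult_left_mono) auto
    ultimately show False by simp
  qed
  then have wh: "h p \<le> w p" if "p \<in> A" for p using p1(2)[OF that] by simp
  \<comment> \<open>Linearises the barrier: exp x - 1 \<ge> x with x = k (d^2 - dist^2), after
    factoring out exp (- k d^2).\<close>
  define e where "e = m * exp (- k * d\<^sup>2) * k"
  have "0 < e" unfolding e_def using \<open>0 < m\<close> \<open>0 < k\<close> by simp
  moreover have "e * (d\<^sup>2 - (dist p q)\<^sup>2) \<le> w p" if "p \<in> cball q d" "d / 2 \<le> dist p q" for p
  proof -
    have "1 + k * (d\<^sup>2 - (dist p q)\<^sup>2) \<le> exp (k * (d\<^sup>2 - (dist p q)\<^sup>2))"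
      by (rule exp_ge_add_one_self)
    then have "exp (- k * d\<^sup>2) * (k * (d\<^sup>2 - (dist p q)\<^sup>2)) \<le>
        exp (- k * d\<^sup>2) * (exp (k * (d\<^sup>2 - (dist p q)\<^sup>2)) - 1)"
      by (intro mult_left_mono) (linarith, simp)
    also have "\<dots> = exp (- k * (dist p q)\<^sup>2) - exp (- k * d\<^sup>2)"
      by (simp add: algebra_simps flip: exp_add)
    finally have "m * (exp (- k * d\<^sup>2) * (k * (d\<^sup>2 - (dist p q)\<^sup>2))) \<le> h p"
      unfolding h_def using \<open>0 < m\<close> by (intro mult_left_mono) auto
    then have "e * (d\<^sup>2 - (dist p q)\<^sup>2) \<le> h p" by (simp add: e_def mult_ac)
    also have "\<dots> \<le> w p" using that by (intro wh) (auto simp: A_def dist_commute)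
    finally show ?thesis .
  qed
  ultimately show ?thesis by blast
qed

text \<open>Otherwise a ball inside the positivity set touches the zero set at an interior point
  \<open>z\<close> of \<open>D\<close>. There \<open>w\<close> is minimal, so its gradient vanishes,
  against the linear growth that \<open>hopf_barrier\<close> forces towards the centre.\<close>

lemma strong_maximum_principle:
  fixes w :: "real \<times> real \<Rightarrow> real"
  assumes "open D" "connected D"
    and diff: "\<And>p. p \<in> D \<Longrightarrow> w differentiable (at p)"
    and lap: "\<And>p. p \<in> D \<Longrightarrow> \<exists>L. has_laplacian w p L \<and> L \<le> M * w p"
    and "0 \<le> M"
    and nonneg: "\<And>p. p \<in> D \<Longrightarrow> 0 \<le> w p"
    and q0: "q0 \<in> D" "0 < w q0"
    and "p \<in> D"
  shows "0 < w p"
proof (rule ccontr)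
  assume "\<not> 0 < w p"
  then have "w p = 0" using nonneg[OF \<open>p \<in> D\<close>] by simp
  have cont: "continuous_on D w"
    using diff by (meson continuous_at_imp_continuous_on differentiable_imp_continuous_within)
  define P where "P = {x \<in> D. 0 < w x}"
  have "open P"
  proof -
    have "P = D \<inter> w -` {0<..}" unfolding P_def by auto
    then show ?thesis using continuous_open_preimage[OF cont \<open>open D\<close>] by simp
  qed
  have "\<not> closedin (top_of_set D) P"
  proof
    assume "closedin (top_of_set D) P"
    moreover have "openin (top_of_set D) P"
      using \<open>open P\<close> \<open>open D\<close> by (auto simp: openin_open_eq P_def)
    ultimately have "P = {} \<or> P = D"
      using \<open>connected D\<close> unfolding connected_clopen by blast
    moreover have "q0 \<in> P" "p \<in> D - P"
      using q0 \<open>p \<in> D\<close> \<open>w p = 0\<close> by (simp_all add: P_def)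
    ultimately show False by blast
  qed
  then obtain z0 where z0: "z0 \<in> D" "z0 \<notin> P" "z0 \<in> closure P"
    unfolding closedin_limpt closure_def by (auto simp: P_def)
  obtain e where "0 < e" and e: "ball z0 e \<subseteq> D"
    using openE[OF \<open>open D\<close> z0(1)] by blast
  obtain q where q: "q \<in> P" "dist q z0 < e / 4"
    using z0(3) \<open>0 < e\<close> unfolding closure_approachable by (auto dest: spec[of _ "e/4"])
  \<comment> \<open>Restricting to a closed ball makes the zero set compact, so a zero nearest to
    \<open>q\<close> exists. As \<open>q\<close> is within e/4 of \<open>z0\<close>, that zero is
    closer to \<open>q\<close> than e/4, and the ball about \<open>q\<close> through it stays inside
    \<open>cball z0 (e/2)\<close>; so no zero outside \<open>Z\<close> can lie in that ball.\<close>
  define Z where "Z = cball z0 (e/2) \<inter> {x \<in> D. w x = 0}"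
  have Z_eq: "Z = {x \<in> cball z0 (e/2). w x = 0}"
    using e \<open>0 < e\<close> unfolding Z_def by force
  have "compact Z"
  proof -
    have "cball z0 (e/2) \<subseteq> D" using e \<open>0 < e\<close> by force
    then have "closed Z"
      unfolding Z_eq by (intro continuous_closed_preimage_constant continuous_on_subset[OF cont]) auto
    moreover have "bounded Z" unfolding Z_def by (intro bounded_Int) auto
    ultimately show ?thesis using compact_eq_bounded_closed by blast
  qed
  have "z0 \<in> Z"
    unfolding Z_eq using z0 \<open>0 < e\<close> nonneg[OF z0(1)] by (auto simp: P_def)
  obtain z where z: "z \<in> Z" "\<And>y. y \<in> Z \<Longrightarrow> dist q z \<le> dist q y"
    using distance_attains_inf[of Z q] compact_imp_closed[OF \<open>compact Z\<close>] \<open>z0 \<in> Z\<close> by auto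
  define d where "d = dist q z"
  have "d < e / 4" unfolding d_def using z(2)[OF \<open>z0 \<in> Z\<close>] q(2) by simp
  have "q \<noteq> z" using q(1) z(1) by (auto simp: P_def Z_def)
  then have "0 < d" by (simp add: d_def)
  have near: "x \<in> cball z0 (e/2) \<and> x \<in> D" if "x \<in> cball q d" for x
  proof -
    have "dist z0 x \<le> dist q z0 + dist q x" by (metis dist_commute dist_triangle)
    then have "dist z0 x < e / 2" using that \<open>d < e / 4\<close> q(2) by auto
    then show ?thesis using e \<open>0 < e\<close> by (auto intro!: subsetD[OF e])
  qed
  have pos: "0 < w x" if "x \<in> ball q d" for x
  proof (rule ccontr)
    assume "\<not> 0 < w x"
    moreover have "x \<in> cball z0 (e/2) \<and> x \<in> D" using near[of x] that by auto
    ultimately have "x \<in> Z" using nonneg[of x] by (auto simp: Z_def)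
    then show False using z(2)[of x] that by (simp add: d_def)
  qed
  obtain c where "0 < c"
    and c: "\<And>x. x \<in> cball q d \<Longrightarrow> d / 2 \<le> dist x q \<Longrightarrow> c * (d\<^sup>2 - (dist x q)\<^sup>2) \<le> w x"
  proof -
    have "\<exists>c>0. \<forall>x\<in>cball q d. d / 2 \<le> dist x q \<longrightarrow> c * (d\<^sup>2 - (dist x q)\<^sup>2) \<le> w x"
    proof (rule hopf_barrier[where M = M])
      show "continuous_on (cball q d) w"
        by (intro continuous_on_subset[OF cont]) (use near in auto)
      show "\<And>x. x \<in> ball q d \<Longrightarrow> \<exists>L. has_laplacian w x L \<and> L \<le> M * w x"
        using near by (intro lap) auto
      show "\<And>x. x \<in> cball q d \<Longrightarrow> 0 \<le> w x" using near nonneg by blast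
    qed (use \<open>0 < d\<close> \<open>0 \<le> M\<close> pos in auto)
    then show thesis using that by blast
  qed
  have "z \<in> D" "w z = 0" using z(1) by (auto simp: Z_def)
  \<comment> \<open>The contradiction: slope 0 at \<open>z\<close>, whereas on the segment from
    \<open>z\<close> to \<open>q\<close> the barrier gives w \<ge> c (d^2 - ((1 - t) d)^2) \<ge> c
    d^2 t.\<close>
  have "(w has_derivative (\<lambda>v. 0)) (at z)"
  proof -
    obtain w' where w': "(w has_derivative w') (at z)"
      using diff[OF \<open>z \<in> D\<close>] by (auto simp: differentiable_def)
    then show ?thesis
      using differential_zero_maxmin[OF \<open>z \<in> D\<close> \<open>open D\<close> w'] nonneg \<open>w z = 0\<close> by auto
  qed
  moreover have "((\<lambda>t. z + t *\<^sub>R (q - z)) has_derivative (\<lambda>t. t *\<^sub>R (q - z))) (at 0)"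
    by (auto intro!: derivative_eq_intros)
  ultimately have "((\<lambda>t. w (z + t *\<^sub>R (q - z))) has_derivative (\<lambda>t. 0)) (at (0::real))"
    using has_derivative_compose[of "\<lambda>t. z + t *\<^sub>R (q - z)" _ 0 UNIV w "\<lambda>v. 0"] by simp
  then have "((\<lambda>t. w (z + t *\<^sub>R (q - z))) has_real_derivative 0) (at 0)"
    by (simp add: has_field_derivative_def lambda_zero)
  then have "((\<lambda>t. w (z + t *\<^sub>R (q - z)) / t) \<longlongrightarrow> 0) (at 0)"
    by (simp add: DERIV_def \<open>w z = 0\<close>)
  then have lim: "((\<lambda>t. w (z + t *\<^sub>R (q - z)) / t) \<longlongrightarrow> 0) (at_right 0)"
    by (rule filterlim_mono) (simp_all add: at_within_le_at)
  have "\<forall>\<^sub>F t in at_right 0. c * d\<^sup>2 \<le> w (z + t *\<^sub>R (q - z)) / t"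
    unfolding eventually_at_right_field
  proof (intro exI[of _ "1/2"] conjI allI impI)
    fix t :: real assume t: "0 < t" "t < 1/2"
    have "dist (z + t *\<^sub>R (q - z)) q = (1 - t) * d"
    proof -
      have "z + t *\<^sub>R (q - z) - q = (1 - t) *\<^sub>R (z - q)" by (simp add: algebra_simps)
      then show ?thesis using t by (simp add: dist_norm d_def norm_minus_commute)
    qed
    moreover have "(1 - t) * d \<le> 1 * d" "1/2 * d \<le> (1 - t) * d"
      using t \<open>0 < d\<close> by (intro mult_right_mono; simp)+
    ultimately have "c * (d\<^sup>2 - ((1 - t) * d)\<^sup>2) \<le> w (z + t *\<^sub>R (q - z))"
      using c[of "z + t *\<^sub>R (q - z)"] by (simp add: dist_commute)
    moreover have "d\<^sup>2 * t \<le> d\<^sup>2 - ((1 - t) * d)\<^sup>2"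
    proof -
      have "d\<^sup>2 - ((1 - t) * d)\<^sup>2 - d\<^sup>2 * t = d\<^sup>2 * (t * (1 - t))"
        by (simp add: power2_eq_square algebra_simps)
      also have "\<dots> \<ge> 0" using t by simp
      finally show ?thesis by simp
    qed
    then have "c * (d\<^sup>2 * t) \<le> c * (d\<^sup>2 - ((1 - t) * d)\<^sup>2)"
      using \<open>0 < c\<close> by (intro mult_left_mono) auto
    ultimately show "c * d\<^sup>2 \<le> w (z + t *\<^sub>R (q - z)) / t"
      using t by (simp add: field_simps)
  qed simp
  from tendsto_lowerbound[OF lim this] have "c * d\<^sup>2 \<le> 0" by simp
  then show False using \<open>0 < c\<close> \<open>0 < d\<close> by (simp add: mult_le_0_iff)
qed

subsection \<open>Moving planes\<close>

definition mirror :: "real \<Rightarrow> real \<times> real \<Rightarrow> real \<times> real" where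
  "mirror lam p = (2 * lam - fst p, snd p)"

text \<open>The weight \<open>g\<close> and the periodicity in the second coordinate, which replaces compactness of
  \<open>closure D\<close>, serve logarithmic polar coordinates; in Cartesian coordinates \<open>g = 1\<close> and
  \<open>Y\<close> is the projection of \<open>closure D\<close>. At the limiting position \<open>lam0\<close> boundary points of
  \<open>D\<close> may be reflected to boundary points.\<close>

locale moving_plane =
  fixes D :: "(real \<times> real) set" and u :: "real \<times> real \<Rightarrow> real" and f g :: "real \<Rightarrow> real"
    and lam0 B L G :: real and Y :: "real set"
  assumes open_D: "open D"
    and cont: "continuous_on (closure D) u"
    and diff: "\<And>p. p \<in> D \<Longrightarrow> u differentiable (at p)"
    and lap: "\<And>p. p \<in> D \<Longrightarrow> has_laplacian u p (- (g (fst p) * f (u p)))"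
    and pos: "\<And>p. p \<in> D \<Longrightarrow> 0 < u p"
    and zero: "\<And>p. p \<in> closure D \<Longrightarrow> p \<notin> D \<Longrightarrow> lam0 \<le> fst p \<Longrightarrow> u p = 0"
    and fst_less: "\<And>p. p \<in> D \<Longrightarrow> fst p < B"
    and mirror_D: "\<And>p lam. p \<in> closure D \<Longrightarrow> lam0 \<le> lam \<Longrightarrow> lam < fst p \<Longrightarrow>
        lam0 < lam \<or> p \<in> D \<Longrightarrow> mirror lam p \<in> D"
    and connected_cap: "\<And>lam. lam0 \<le> lam \<Longrightarrow> connected (D \<inter> {p. lam < fst p})"
    and asymmetric: "\<And>lam. lam0 \<le> lam \<Longrightarrow> lam < B \<Longrightarrow>
        \<exists>p\<in>closure D. p \<notin> D \<and> lam < fst p \<and> 0 < u (mirror lam p)"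
    and f_nonneg: "\<And>s. 0 \<le> f s"
    and f_lipschitz: "\<And>s t. s \<in> u ` closure D \<Longrightarrow> t \<in> u ` closure D \<Longrightarrow> \<bar>f s - f t\<bar> \<le> L * \<bar>s - t\<bar>"
    and L_nonneg: "0 \<le> L"
    and g_nonneg: "\<And>x. 0 \<le> g x"
    and g_antimono: "\<And>x y. x \<le> y \<Longrightarrow> g y \<le> g x"
    and g_bound: "\<And>p. p \<in> D \<Longrightarrow> g (fst p) \<le> G"
    and compact_slab: "compact (closure D \<inter> (UNIV \<times> Y))"
    and periodic: "\<And>p. p \<in> closure D \<Longrightarrow>
        \<exists>y\<in>Y. \<forall>x. ((x, y) \<in> closure D \<longleftrightarrow> (x, snd p) \<in> closure D) \<and> u (x, y) = u (x, snd p)"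
    and G_nonneg: "0 \<le> G"
begin

section \<open>The difference between reflected and original function\<close>

definition gap :: "real \<Rightarrow> real \<times> real \<Rightarrow> real" where
  "gap lam p = u (mirror lam p) - u p"

lemma gap_eq_0: "fst p = lam \<Longrightarrow> gap lam p = 0"
  by (cases p) (simp add: gap_def mirror_def)

lemma u_nonneg: "p \<in> closure D \<Longrightarrow> 0 \<le> u p"
  using continuous_ge_on_closure[OF cont] pos by (meson less_imp_le)

lemma fst_le: "p \<in> closure D \<Longrightarrow> fst p \<le> B"
  using continuous_le_on_closure[of D fst p B] fst_less
  by (simp add: continuous_on_fst less_imp_le)

lemma mirror_tendsto:
  assumes "(l \<longlongrightarrow> lam) F" "(q \<longlongrightarrow> p) F"
  shows "((\<lambda>n. mirror (l n) (q n)) \<longlongrightarrow> mirror lam p) F"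
  unfolding mirror_def by (intro tendsto_intros assms)

text \<open>For boundary points \<open>mirror_D\<close> is silent at \<open>lam = lam0\<close>.
  Shifting the line slightly to the right puts the image into \<open>D\<close>, and the limit stays
  in the closure.\<close>

lemma mirror_closure:
  assumes "p \<in> closure D" "lam0 \<le> lam" "lam \<le> fst p"
  shows "mirror lam p \<in> closure D"
proof (cases "lam = fst p")
  case True
  then show ?thesis using assms by (simp add: mirror_def)
next
  case False
  show ?thesis
  proof (rule Lim_in_closed_set[where F = "at_right lam"])
    have "\<forall>\<^sub>F l in at_right lam. l \<in> {lam<..<fst p}"
      using False assms by (intro eventually_at_right_real) auto
    then show "\<forall>\<^sub>F l in at_right lam. mirror l p \<in> closure D"
    proof eventually_elim
      case (elim l)
      then have "mirror l p \<in> D" using assms by (intro mirror_D) auto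
      then show ?case using closure_subset by blast
    qed
    show "((\<lambda>l. mirror l p) \<longlongrightarrow> mirror lam p) (at_right lam)"
      by (intro mirror_tendsto tendsto_intros)
  qed auto
qed

lemma continuous_on_gap:
  assumes "lam0 \<le> lam"
  shows "continuous_on (closure D \<inter> {p. lam \<le> fst p}) (gap lam)"
proof -
  have "continuous_on (closure D \<inter> {p. lam \<le> fst p}) (\<lambda>p. u (mirror lam p))"
  proof (rule continuous_on_compose2[OF cont])
    show "continuous_on (closure D \<inter> {p. lam \<le> fst p}) (mirror lam)"
      unfolding mirror_def by (intro continuous_intros)
    show "mirror lam ` (closure D \<inter> {p. lam \<le> fst p}) \<subseteq> closure D"
      using mirror_closure assms by auto
  qed
  moreover have "continuous_on (closure D \<inter> {p. lam \<le> fst p}) u"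
    by (rule continuous_on_subset[OF cont]) auto
  ultimately show ?thesis
    unfolding gap_def by (intro continuous_intros)
qed

lemma gap_differentiable:
  assumes "p \<in> D" "lam0 \<le> lam" "lam < fst p"
  shows "gap lam differentiable (at p)"
proof -
  have "mirror lam p \<in> D"
    using assms closure_subset by (intro mirror_D) auto
  then have "u differentiable (at (mirror lam p))" by (rule diff)
  moreover have "mirror lam differentiable (at p)"
    unfolding mirror_def differentiable_def
    by (rule exI[of _ "\<lambda>h. (- fst h, snd h)"]) (auto intro!: derivative_eq_intros)
  ultimately have "(\<lambda>p. u (mirror lam p)) differentiable (at p)"
    using differentiable_chain_at[of "mirror lam" p u] by (simp add: o_def)
  then show ?thesis
    unfolding gap_def using diff[OF assms(1)] by (intro derivative_intros)
qed

text \<open>The mirror image lies to the left, where the weight \<open>g\<close> is at least as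
  large; as \<open>f\<close> is nonnegative, replacing that weight by the one at \<open>p\<close>
  only raises the right-hand side, and the Lipschitz bound remains. The absolute value is kept
  because the estimate is used both where \<open>gap\<close> is nonnegative and where it is assumed
  negative.\<close>

lemma gap_laplacian:
  assumes "p \<in> D" "lam0 \<le> lam" "lam < fst p"
  shows "\<exists>E. has_laplacian (gap lam) p E \<and> E \<le> G * L * \<bar>gap lam p\<bar>"
proof -
  have mD: "mirror lam p \<in> D"
    using assms closure_subset by (intro mirror_D) auto
  define v where "v = u (mirror lam p)"
  let ?E = "- (g (2 * lam - fst p) * f v) - - (g (fst p) * f (u p))"
  have "has_laplacian (\<lambda>q. u (2 * lam - fst q, snd q)) p (- (g (2 * lam - fst p) * f v))"
    using lap[OF mD] by (intro has_laplacian_reflect) (simp add: mirror_def v_def)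
  then have "has_laplacian (gap lam) p ?E"
    unfolding gap_def mirror_def by (intro has_laplacian_diff lap assms)
  moreover have "?E \<le> G * L * \<bar>gap lam p\<bar>"
  proof -
    have "g (fst p) * f v \<le> g (2 * lam - fst p) * f v"
      using assms by (intro mult_right_mono g_antimono f_nonneg) auto
    then have "?E \<le> g (fst p) * (f (u p) - f v)" by (simp add: algebra_simps)
    also have "\<dots> \<le> g (fst p) * \<bar>f (u p) - f v\<bar>"
      by (intro mult_left_mono g_nonneg) auto
    also have "\<dots> \<le> G * (L * \<bar>u p - v\<bar>)"
    proof (rule mult_mono)
      show "\<bar>f (u p) - f v\<bar> \<le> L * \<bar>u p - v\<bar>"
        unfolding v_def using assms(1) mD closure_subset by (intro f_lipschitz) blast+
    qed (use g_bound assms G_nonneg in auto)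
    finally show ?thesis by (simp add: gap_def v_def abs_minus_commute mult.assoc)
  qed
  ultimately show ?thesis by blast
qed

text \<open>At the point supplied by \<open>asymmetric\<close>, \<open>u\<close> vanishes but its
  mirrored value does not, so \<open>gap\<close> is not identically zero on the connected cap and
  the strong maximum principle applies.\<close>

lemma gap_pos:
  assumes lam: "lam0 \<le> lam" "lam < B"
    and nonneg: "\<And>p. p \<in> closure D \<Longrightarrow> lam \<le> fst p \<Longrightarrow> 0 \<le> gap lam p"
    and p: "p \<in> D" "lam < fst p"
  shows "0 < gap lam p"
proof -
  let ?S = "closure D \<inter> {p. lam \<le> fst p}"
  obtain p0 where p0: "p0 \<in> closure D" "p0 \<notin> D" "lam < fst p0" "0 < u (mirror lam p0)"
    using asymmetric[OF lam] by blast
  then have "0 < gap lam p0" using zero[of p0] lam by (simp add: gap_def)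
  moreover have "p0 \<in> ?S" using p0 by auto
  ultimately obtain d where "0 < d"
    and d: "\<And>q. q \<in> ?S \<Longrightarrow> dist q p0 < d \<Longrightarrow> dist (gap lam q) (gap lam p0) < gap lam p0"
    using continuous_on_gap[OF lam(1)] unfolding continuous_on_iff by blast
  \<comment> \<open>\<open>p0\<close> lies on the boundary, while the maximum principle asks for
    positivity at a point of the open cap; the bound \<open>fst p0 - lam\<close> keeps
    \<open>q\<close> to the right of the line.\<close>
  obtain q where q: "q \<in> D" "dist q p0 < min d (fst p0 - lam)"
    using p0(1) \<open>0 < d\<close> p0(3) unfolding closure_approachable
    by (metis diff_gt_0_iff_gt min_less_iff_conj)
  have "\<bar>fst q - fst p0\<bar> \<le> dist q p0"
    using dist_fst_le[of q p0] by (simp add: dist_real_def)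
  then have "lam < fst q" using q(2) by auto
  then have "q \<in> ?S" using q(1) closure_subset by auto
  then have "0 < gap lam q" using d[of q] q(2) by (auto simp: dist_real_def)
  show ?thesis
  proof (rule strong_maximum_principle[where M = "G * L" and D = "D \<inter> {p. lam < fst p}"])
    have "open {p. lam < fst (p :: real \<times> real)}"
      by (intro open_Collect_less continuous_intros)
    then show "open (D \<inter> {p. lam < fst p})" using open_D by blast
    show "connected (D \<inter> {p. lam < fst p})" using connected_cap lam by blast
    show "q \<in> D \<inter> {p. lam < fst p}" "0 < gap lam q" "p \<in> D \<inter> {p. lam < fst p}"
      using q \<open>lam < fst q\<close> \<open>0 < gap lam q\<close> p by auto
    show nn: "0 \<le> gap lam x" if "x \<in> D \<inter> {p. lam < fst p}" for x
      using that closure_subset by (intro nonneg) auto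
    show "gap lam differentiable (at x)" if "x \<in> D \<inter> {p. lam < fst p}" for x
      using that lam by (intro gap_differentiable) auto
    show "\<exists>E. has_laplacian (gap lam) x E \<and> E \<le> G * L * gap lam x"
      if "x \<in> D \<inter> {p. lam < fst p}" for x
      using gap_laplacian[of x lam] that lam nn[OF that] by auto
    show "0 \<le> G * L" using G_nonneg L_nonneg by simp
  qed
qed

text \<open>In \<open>periodic\<close> one \<open>y\<close> serves all first coordinates, so a point
  and its mirror images are moved into the compact slab together and every \<open>gap lam\<close>
  keeps its value.\<close>

lemma periodic_gap:
  assumes "p \<in> closure D"
  obtains y where "y \<in> Y" "(fst p, y) \<in> closure D" "\<And>lam. gap lam (fst p, y) = gap lam p"
proof -
  obtain y where "y \<in> Y"
    "\<And>x. ((x, y) \<in> closure D \<longleftrightarrow> (x, snd p) \<in> closure D) \<and> u (x, y) = u (x, snd p)"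
    using periodic[OF assms] by blast
  then show thesis using assms that[of y] by (simp add: gap_def mirror_def)
qed

text \<open>Maximum principle for narrow domains: divide \<open>gap\<close> by a positive strictly
  superharmonic function \<open>\<phi>\<close>. At a negative minimum m of the quotient,
  \<open>gap - m \<phi>\<close> has a local minimum, which the Laplacian of \<open>\<phi>\<close>
  rules out.\<close>

lemma narrow_strip:
  assumes lam: "lam0 \<le> lam"
    and \<delta>: "0 < \<delta>" "(G * L + 1) * \<delta>\<^sup>2 \<le> 1"
    and far: "\<And>p. p \<in> closure D \<Longrightarrow> lam + \<delta> \<le> fst p \<Longrightarrow> 0 \<le> gap lam p"
    and p: "p \<in> closure D" "lam \<le> fst p"
  shows "0 \<le> gap lam p"
proof (rule ccontr)
  assume neg: "\<not> 0 \<le> gap lam p"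
  define M where "M = G * L"
  have "0 \<le> M" unfolding M_def using G_nonneg L_nonneg by simp
  define N where "N = (closure D \<inter> (UNIV \<times> Y)) \<inter> {p. lam \<le> fst p \<and> fst p \<le> lam + \<delta>}"
  \<comment> \<open>The bound on \<open>\<delta>\<close> keeps \<open>\<phi>\<close> between 1 and 2
    on the strip, so the Lipschitz term is at most - 2 M m at the minimum. The barrier contributes 2
    (M + 1) m, and the surplus 1 in the coefficient leaves 2 m < 0.\<close>
  define \<phi> where "\<phi> p = 2 - (M + 1) * (fst p - lam)\<^sup>2" for p :: "real \<times> real"
  have \<phi>: "1 \<le> \<phi> q" "\<phi> q \<le> 2" if "lam \<le> fst q" "fst q \<le> lam + \<delta>" for q
  proof -
    have "(fst q - lam)\<^sup>2 \<le> \<delta>\<^sup>2" using that by (intro power_mono) auto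
    then have "(M + 1) * (fst q - lam)\<^sup>2 \<le> (M + 1) * \<delta>\<^sup>2"
      using \<open>0 \<le> M\<close> by (intro mult_left_mono) auto
    then show "1 \<le> \<phi> q" using \<delta> by (simp add: \<phi>_def M_def)
    show "\<phi> q \<le> 2" using \<open>0 \<le> M\<close> by (simp add: \<phi>_def)
  qed
  have "closed {p. lam \<le> fst p \<and> fst (p :: real \<times> real) \<le> lam + \<delta>}"
    by (intro closed_Collect_conj closed_Collect_le continuous_intros)
  then have "compact N" unfolding N_def using compact_slab by (rule compact_Int_closed[rotated])
  have "fst p < lam + \<delta>" using far[OF p(1)] neg by force
  obtain y where y: "y \<in> Y" "(fst p, y) \<in> closure D" "gap lam (fst p, y) = gap lam p"
    using periodic_gap[OF p(1)] by metis
  have yN: "(fst p, y) \<in> N"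
    unfolding N_def using y p \<open>fst p < lam + \<delta>\<close> by auto
  have "continuous_on N (\<lambda>q. gap lam q / \<phi> q)"
  proof (intro continuous_on_divide)
    show "continuous_on N (gap lam)"
      by (rule continuous_on_subset[OF continuous_on_gap[OF lam]]) (auto simp: N_def)
    show "continuous_on N \<phi>" unfolding \<phi>_def by (intro continuous_intros)
    have "1 \<le> \<phi> q" if "q \<in> N" for q using that by (intro \<phi>(1)) (auto simp: N_def)
    then show "\<forall>q\<in>N. \<phi> q \<noteq> 0" by force
  qed
  then obtain p1 where p1: "p1 \<in> N" "\<And>q. q \<in> N \<Longrightarrow> gap lam p1 / \<phi> p1 \<le> gap lam q / \<phi> q"
    using continuous_attains_inf[OF \<open>compact N\<close>] yN by blast
  define m where "m = gap lam p1 / \<phi> p1"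
  have "m \<le> gap lam p / \<phi> (fst p, y)" unfolding m_def using p1(2)[OF yN] y by simp
  also have "\<dots> < 0" using neg \<phi>(1)[of "(fst p, y)"] p \<open>fst p < lam + \<delta>\<close> by (auto intro: divide_neg_pos)
  finally have "m < 0" .
  have p1N: "p1 \<in> closure D" "lam \<le> fst p1" "fst p1 \<le> lam + \<delta>" using p1(1) by (auto simp: N_def)
  have gap_p1: "gap lam p1 = m * \<phi> p1" unfolding m_def using \<phi>(1)[of p1] p1N by auto
  then have "gap lam p1 < 0" using \<open>m < 0\<close> \<phi>(1)[of p1] p1N by (simp add: mult_neg_pos)
  have "p1 \<in> D"
  proof (rule ccontr)
    assume "p1 \<notin> D"
    then have "u p1 = 0" using zero[of p1] p1N lam by auto
    moreover have "0 \<le> u (mirror lam p1)" using p1N lam by (intro u_nonneg mirror_closure) auto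
    ultimately show False using \<open>gap lam p1 < 0\<close> by (simp add: gap_def)
  qed
  have "lam < fst p1" using p1N gap_eq_0[of p1 lam] \<open>gap lam p1 < 0\<close> by force
  have "fst p1 < lam + \<delta>" using p1N far[of p1] \<open>gap lam p1 < 0\<close> by force
  obtain E where E: "has_laplacian (gap lam) p1 E" "E \<le> M * \<bar>gap lam p1\<bar>"
    using gap_laplacian[OF \<open>p1 \<in> D\<close> lam \<open>lam < fst p1\<close>] unfolding M_def by blast
  have "has_laplacian (\<lambda>q. gap lam q - m * \<phi> q) p1 (E - (- 2 * (M + 1) * m))"
    unfolding \<phi>_def by (intro has_laplacian_diff E has_laplacian_strip_barrier)
  moreover have "\<forall>\<^sub>F q in nhds p1. gap lam p1 - m * \<phi> p1 \<le> gap lam q - m * \<phi> q"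
    unfolding eventually_nhds
  proof (intro exI conjI ballI)
    show "open (D \<inter> {q. lam < fst q \<and> fst q < lam + \<delta>})"
      by (intro open_Int open_D open_Collect_conj open_Collect_less continuous_intros)
    show "p1 \<in> D \<inter> {q. lam < fst q \<and> fst q < lam + \<delta>}"
      using \<open>p1 \<in> D\<close> \<open>lam < fst p1\<close> \<open>fst p1 < lam + \<delta>\<close> by simp
    fix q assume q: "q \<in> D \<inter> {q. lam < fst q \<and> fst q < lam + \<delta>}"
    then have "q \<in> closure D" using closure_subset by auto
    \<comment> \<open>The minimum was taken over the compact slab only, so \<open>q\<close> is first
      moved into it; \<open>\<phi>\<close> depends on the first coordinate alone and does not
      change.\<close>
    then obtain y' where y': "y' \<in> Y" "(fst q, y') \<in> closure D" "gap lam (fst q, y') = gap lam q"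
      using periodic_gap by metis
    then have "(fst q, y') \<in> N" using q by (auto simp: N_def)
    from p1(2)[OF this] have "m \<le> gap lam q / \<phi> q"
      using y' by (simp add: m_def \<phi>_def)
    then have "m * \<phi> q \<le> gap lam q" using \<phi>(1)[of q] q by (simp add: field_simps)
    then show "gap lam p1 - m * \<phi> p1 \<le> gap lam q - m * \<phi> q" using gap_p1 by simp
  qed
  ultimately have "0 \<le> E - (- 2 * (M + 1) * m)"
    by (rule has_laplacian_local_min)
  moreover have "M * \<bar>gap lam p1\<bar> \<le> M * (- 2 * m)"
  proof (rule mult_left_mono[OF _ \<open>0 \<le> M\<close>])
    have "- m * \<phi> p1 \<le> - m * 2" using \<phi>(2)[of p1] p1N \<open>m < 0\<close> by (intro mult_left_mono) auto
    then show "\<bar>gap lam p1\<bar> \<le> - 2 * m" using \<open>gap lam p1 < 0\<close> gap_p1 by linarith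
  qed
  ultimately show False using E(2) \<open>m < 0\<close> by (simp add: algebra_simps)
qed

lemma gap_tendsto:
  assumes "(l \<longlongrightarrow> lam) F" "(q \<longlongrightarrow> p) F" "p \<in> closure D" "lam0 \<le> lam" "lam \<le> fst p"
    and ev: "\<forall>\<^sub>F n in F. q n \<in> closure D \<and> lam0 \<le> l n \<and> l n \<le> fst (q n)"
  shows "((\<lambda>n. gap (l n) (q n)) \<longlongrightarrow> gap lam p) F"
  unfolding gap_def
proof (intro tendsto_diff continuous_on_tendsto_compose[OF cont])
  show "((\<lambda>n. mirror (l n) (q n)) \<longlongrightarrow> mirror lam p) F"
    by (intro mirror_tendsto assms)
  show "mirror lam p \<in> closure D" by (intro mirror_closure assms)
  show "\<forall>\<^sub>F n in F. mirror (l n) (q n) \<in> closure D"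
    using ev by eventually_elim (auto intro: mirror_closure)
  show "\<forall>\<^sub>F n in F. q n \<in> closure D"
    using ev by eventually_elim auto
qed (use assms in auto)

text \<open>Take the supremum \<open>s\<close> of the bad positions. By \<open>narrow_strip\<close>
  every bad position has a witness at distance at least \<open>\<delta>\<close> from its line, with
  \<open>\<delta>\<close> independent of the position. Witnesses along bad positions tending to
  \<open>s\<close> therefore accumulate strictly to the right of the line at \<open>s\<close>, at a
  point where \<open>gap s\<close> is both nonpositive and positive.\<close>

lemma gap_nonneg:
  assumes "lam0 \<le> lam" "lam < B" "p \<in> closure D" "lam \<le> fst p"
  shows "0 \<le> gap lam p"
proof (rule ccontr)
  assume neg: "\<not> 0 \<le> gap lam p"
  define T where "T = {l. lam0 \<le> l \<and> l < B \<and> (\<exists>q\<in>closure D. l \<le> fst q \<and> gap l q < 0)}"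
  have "lam \<in> T" unfolding T_def using assms neg by force
  have "bdd_above T" unfolding T_def by (intro bdd_aboveI[of _ B]) auto
  define s where "s = Sup T"
  have T_le: "l \<le> s" if "l \<in> T" for l
    unfolding s_def using that \<open>bdd_above T\<close> by (rule cSup_upper)
  have "lam0 \<le> s" using T_le[OF \<open>lam \<in> T\<close>] assms by simp
  define \<delta> where "\<delta> = 1 / sqrt (G * L + 1)"
  have "0 \<le> G * L" using G_nonneg L_nonneg by simp
  then have \<delta>: "0 < \<delta>" "(G * L + 1) * \<delta>\<^sup>2 \<le> 1"
    unfolding \<delta>_def by (simp_all add: power_divide)
  have far: "\<exists>q\<in>closure D \<inter> (UNIV \<times> Y). l + \<delta> \<le> fst q \<and> gap l q < 0" if "l \<in> T" for l
  proof -
    have "\<exists>q\<in>closure D. l + \<delta> \<le> fst q \<and> gap l q < 0"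
    proof (rule ccontr)
      assume "\<not> ?thesis"
      then have "\<And>q. q \<in> closure D \<Longrightarrow> l + \<delta> \<le> fst q \<Longrightarrow> 0 \<le> gap l q"
        by force
      then show False using narrow_strip[OF _ \<delta>, of l] that by (force simp: T_def)
    qed
    then obtain q where q: "q \<in> closure D" "l + \<delta> \<le> fst q" "gap l q < 0" by blast
    obtain y where "y \<in> Y" "(fst q, y) \<in> closure D" "gap l (fst q, y) = gap l q"
      using periodic_gap[OF q(1)] by metis
    then show ?thesis using q by (intro bexI[of _ "(fst q, y)"]) auto
  qed
  \<comment> \<open>The starting position of the method: a cap narrower than \<open>\<delta>\<close>
    has no room for a witness.\<close>
  have "l \<le> B - \<delta>" if "l \<in> T" for l
    using far[OF that] fst_le by force
  then have "s \<le> B - \<delta>" unfolding s_def using \<open>lam \<in> T\<close> by (intro cSup_least) auto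
  then have "s < B" using \<delta> by simp
  have nonneg_s: "0 \<le> gap s q" if q: "q \<in> closure D" "s \<le> fst q" for q
  proof (cases "s = fst q")
    case True
    then show ?thesis using gap_eq_0 by simp
  next
    case False
    have ev: "\<forall>\<^sub>F l in at_right s. l \<in> {s<..<min B (fst q)}"
      using False q \<open>s < B\<close> by (intro eventually_at_right_real) auto
    have "((\<lambda>l. gap l q) \<longlongrightarrow> gap s q) (at_right s)"
    proof (rule gap_tendsto)
      show "\<forall>\<^sub>F l in at_right s. q \<in> closure D \<and> lam0 \<le> l \<and> l \<le> fst q"
        using ev by eventually_elim (use \<open>lam0 \<le> s\<close> q in auto)
    qed (use q \<open>lam0 \<le> s\<close> in auto)
    moreover have "\<forall>\<^sub>F l in at_right s. 0 \<le> gap l q"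
      using ev
    proof eventually_elim
      case (elim l)
      then have "l \<notin> T" using T_le by force
      then show ?case using elim \<open>lam0 \<le> s\<close> q by (auto simp: T_def not_less)
    qed
    ultimately show ?thesis by (intro tendsto_lowerbound) auto
  qed
  then have "s \<notin> T" by (force simp: T_def)
  \<comment> \<open>The strict inequality is what allows \<open>mirror_D\<close> to send a boundary
    limit point \<open>q0\<close> into \<open>D\<close> at the end.\<close>
  then have "lam0 < s" using T_le[OF \<open>lam \<in> T\<close>] \<open>lam \<in> T\<close> \<open>lam0 \<le> s\<close> assms(1)
    by (metis order_antisym order_le_less)
  have "\<exists>l\<in>T. s - 1 / real (Suc n) < l" for n
    using less_cSupD[of T "s - 1 / real (Suc n)"] \<open>lam \<in> T\<close> by (auto simp: s_def)
  then obtain l where l: "\<And>n. l n \<in> T" "\<And>n. s - 1 / real (Suc n) < l n" by metis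
  have "l \<longlonglongrightarrow> s"
  proof (rule tendsto_sandwich)
    show "(\<lambda>n. s - 1 / real (Suc n)) \<longlonglongrightarrow> s"
      using tendsto_diff[OF tendsto_const[of s] LIMSEQ_Suc[OF lim_1_over_n]] by simp
    show "\<forall>\<^sub>F n in sequentially. s - 1 / real (Suc n) \<le> l n" using less_imp_le[OF l(2)] by simp
    show "\<forall>\<^sub>F n in sequentially. l n \<le> s" using l(1) T_le by auto
  qed auto
  have "\<forall>n. \<exists>q\<in>closure D \<inter> (UNIV \<times> Y). l n + \<delta> \<le> fst q \<and> gap (l n) q < 0"
    using far l(1) by blast
  then obtain q where q: "\<And>n. q n \<in> closure D \<inter> (UNIV \<times> Y)" "\<And>n. l n + \<delta> \<le> fst (q n)"
      "\<And>n. gap (l n) (q n) < 0"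
    by metis
  obtain q0 r where "q0 \<in> closure D \<inter> (UNIV \<times> Y)" "strict_mono r" and lim: "(q \<circ> r) \<longlonglongrightarrow> q0"
    using compact_slab q(1) unfolding compact_def by metis
  then have "q0 \<in> closure D" by auto
  have lr: "(\<lambda>n. l (r n)) \<longlonglongrightarrow> s"
    using LIMSEQ_subseq_LIMSEQ[OF \<open>l \<longlonglongrightarrow> s\<close> \<open>strict_mono r\<close>] by (simp add: o_def)
  have qr: "(\<lambda>n. q (r n)) \<longlonglongrightarrow> q0" using lim by (simp add: o_def)
  have "s + \<delta> \<le> fst q0"
  proof (rule tendsto_le)
    show "(\<lambda>n. fst (q (r n))) \<longlonglongrightarrow> fst q0" by (rule tendsto_fst[OF qr])
    show "(\<lambda>n. l (r n) + \<delta>) \<longlonglongrightarrow> s + \<delta>" by (intro tendsto_intros lr)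
  qed (use q(2) in auto)
  then have "s < fst q0" using \<delta> by simp
  have "gap s q0 \<le> 0"
  proof (rule tendsto_upperbound)
    show "(\<lambda>n. gap (l (r n)) (q (r n))) \<longlonglongrightarrow> gap s q0"
    proof (rule gap_tendsto[OF lr qr])
      have "l n \<le> fst (q n)" for n using q(2)[of n] \<delta> by simp
      then show "\<forall>\<^sub>F n in sequentially. q (r n) \<in> closure D \<and> lam0 \<le> l (r n) \<and> l (r n) \<le> fst (q (r n))"
        using q(1) l(1) by (auto simp: T_def)
    qed (use \<open>q0 \<in> closure D\<close> \<open>lam0 \<le> s\<close> \<open>s < fst q0\<close> in auto)
    show "\<forall>\<^sub>F n in sequentially. gap (l (r n)) (q (r n)) \<le> 0" using less_imp_le[OF q(3)] by simp
  qed auto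
  moreover have "0 < gap s q0"
  proof (cases "q0 \<in> D")
    case True
    then show ?thesis
      using gap_pos[OF \<open>lam0 \<le> s\<close> \<open>s < B\<close> nonneg_s] \<open>s < fst q0\<close> by blast
  next
    case False
    then have "u q0 = 0" using zero \<open>q0 \<in> closure D\<close> \<open>lam0 \<le> s\<close> \<open>s < fst q0\<close> by auto
    moreover have "0 < u (mirror s q0)"
      using \<open>q0 \<in> closure D\<close> \<open>lam0 < s\<close> \<open>s < fst q0\<close> by (intro pos mirror_D) auto
    ultimately show ?thesis by (simp add: gap_def)
  qed
  ultimately show False by simp
qed

text \<open>Hopf's lemma on the mirror line through \<open>p\<close>: \<open>gap\<close> vanishes at
  \<open>p\<close> and grows at least linearly to its right, while its derivative across the line is
  -2 times the derivative of \<open>u\<close>.\<close>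

theorem fst_derivative_nonzero:
  assumes "p \<in> D" "lam0 \<le> fst p"
  shows "\<not> ((\<lambda>s. u (s, snd p)) has_real_derivative 0) (at (fst p))"
proof
  assume der: "((\<lambda>s. u (s, snd p)) has_real_derivative 0) (at (fst p))"
  define lam where "lam = fst p"
  have lam: "lam0 \<le> lam" "lam < B" unfolding lam_def using assms fst_less by auto
  obtain e where "0 < e" and e: "cball p e \<subseteq> D"
    using open_D assms(1) open_contains_cball by blast
  \<comment> \<open>The ball of radius \<open>d\<close> about \<open>q\<close> touches the line at
    \<open>p\<close> from the right and stays inside \<open>cball p e\<close>.\<close>
  define d where "d = e / 2"
  have "0 < d" unfolding d_def using \<open>0 < e\<close> by simp
  define q where "q = (lam + d, snd p)"
  have "dist p q = d" using \<open>0 < d\<close> by (cases p) (simp add: q_def lam_def dist_prod_def dist_real_def)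
  have sub: "x \<in> D \<and> lam \<le> fst x" if "x \<in> cball q d" for x
  proof -
    have "dist p x \<le> e" using dist_triangle[of p x q] that \<open>dist p q = d\<close> by (simp add: d_def)
    moreover have "\<bar>fst x - fst q\<bar> \<le> d"
      using dist_fst_le[of q x] that by (simp add: dist_real_def)
    ultimately show ?thesis using e by (auto simp: q_def)
  qed
  have sub': "lam < fst x" if "x \<in> ball q d" for x
  proof -
    have "\<bar>fst x - fst q\<bar> < d"
      using dist_fst_le[of q x] that by (simp add: dist_real_def)
    then show ?thesis by (auto simp: q_def)
  qed
  obtain c where "0 < c"
    and c: "\<And>x. x \<in> cball q d \<Longrightarrow> d / 2 \<le> dist x q \<Longrightarrow> c * (d\<^sup>2 - (dist x q)\<^sup>2) \<le> gap lam x"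
  proof -
    have "\<exists>c>0. \<forall>x\<in>cball q d. d / 2 \<le> dist x q \<longrightarrow> c * (d\<^sup>2 - (dist x q)\<^sup>2) \<le> gap lam x"
    proof (rule hopf_barrier[where M = "G * L"])
      show "continuous_on (cball q d) (gap lam)"
        by (intro continuous_on_subset[OF continuous_on_gap[OF lam(1)]])
          (use sub closure_subset in blast)
      show pos: "0 < gap lam x" if "x \<in> ball q d" for x
        using that sub sub' gap_nonneg[OF lam] by (intro gap_pos lam) auto
      show "\<exists>E. has_laplacian (gap lam) x E \<and> E \<le> G * L * gap lam x" if "x \<in> ball q d" for x
        using gap_laplacian[of x lam] that sub[of x] sub'[of x] lam pos[OF that] by auto
      show "0 \<le> gap lam x" if "x \<in> cball q d" for x
        using sub[OF that] closure_subset by (intro gap_nonneg lam) auto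
    qed (use \<open>0 < d\<close> G_nonneg L_nonneg in auto)
    then show thesis using that by blast
  qed
  define h where "h t = u (lam - t, snd p) - u (lam + t, snd p)" for t
  have "(h has_real_derivative 0) (at 0)"
  proof -
    have "((\<lambda>t. lam - t) has_real_derivative - 1) (at 0)" "((\<lambda>t. lam + t) has_real_derivative 1) (at 0)"
      by (auto intro!: derivative_eq_intros)
    moreover have "((\<lambda>s. u (s, snd p)) has_real_derivative 0) (at (lam - 0))"
      "((\<lambda>s. u (s, snd p)) has_real_derivative 0) (at (lam + 0))"
      using der by (simp_all add: lam_def)
    ultimately show ?thesis
      unfolding h_def using DERIV_diff[OF DERIV_chain2 DERIV_chain2] by fastforce
  qed
  then have "((\<lambda>t. h t / t) \<longlongrightarrow> 0) (at 0)"
    by (simp add: DERIV_def h_def)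
  then have "((\<lambda>t. h t / t) \<longlongrightarrow> 0) (at_right 0)"
    by (rule filterlim_mono) (simp_all add: at_within_le_at)
  moreover have "\<forall>\<^sub>F t in at_right 0. c * d \<le> h t / t"
    unfolding eventually_at_right_field
  proof (intro exI[of _ "d/2"] conjI allI impI)
    fix t :: real assume t: "0 < t" "t < d/2"
    have dist: "dist (lam + t, snd p) q = d - t"
      using t by (simp add: q_def dist_prod_def dist_real_def)
    have "c * (d * t) \<le> c * (d\<^sup>2 - (d - t)\<^sup>2)"
    proof (intro mult_left_mono)
      have "d\<^sup>2 - (d - t)\<^sup>2 - d * t = t * (d - t)" by (simp add: power2_eq_square algebra_simps)
      also have "\<dots> \<ge> 0" using t by simp
      finally show "d * t \<le> d\<^sup>2 - (d - t)\<^sup>2" by simp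
    qed (use \<open>0 < c\<close> in auto)
    also have "\<dots> \<le> gap lam (lam + t, snd p)"
      using c[of "(lam + t, snd p)"] dist t by (simp add: dist_commute)
    also have "\<dots> = h t" by (simp add: gap_def mirror_def h_def)
    finally show "c * d \<le> h t / t" using t by (simp add: field_simps)
  qed (use \<open>0 < d\<close> in simp)
  ultimately have "c * d \<le> 0" by (intro tendsto_lowerbound) auto
  then show False using \<open>0 < c\<close> \<open>0 < d\<close> by (simp add: mult_le_0_iff)
qed

end

subsection \<open>Regularity in Cartesian and logarithmic polar coordinates\<close>

lemma locally_lipschitz_compact:
  assumes "locally_lipschitz f" "compact S"
  shows "\<exists>L\<ge>0. \<forall>s\<in>S. \<forall>t\<in>S. \<bar>f s - f t\<bar> \<le> L * \<bar>s - t\<bar>"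
proof -
  \<comment> \<open>\<open>local_lipschitz\<close> speaks of families depending on time; a single
    dummy time makes its compactness theorem available for \<open>f\<close>.\<close>
  have "local_lipschitz {0::real} S (\<lambda>_. f)"
    unfolding local_lipschitz_def
  proof (intro ballI)
    fix s assume "s \<in> S"
    obtain e L where "0 < e" and L: "L-lipschitz_on (ball s e) f"
      using assms(1) unfolding locally_lipschitz_def by blast
    have "L-lipschitz_on (cball s (e/2) \<inter> S) f"
      by (rule lipschitz_on_subset[OF L]) (use \<open>0 < e\<close> in auto)
    then show "\<exists>u>0. \<exists>L. \<forall>t\<in>cball t u \<inter> {0}. L-lipschitz_on (cball s u \<inter> S) f" for t :: real
      using \<open>0 < e\<close> by (intro exI[of _ "e/2"]) auto
  qed
  then obtain L where "L-lipschitz_on S f"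
    by (rule local_lipschitz_compact_implies_lipschitz) (use assms(2) in auto)
  then show ?thesis
    unfolding lipschitz_on_def by (auto simp: dist_real_def)
qed

lemma has_real_derivative_iff_mult:
  "(f has_real_derivative D) F \<longleftrightarrow> (f has_derivative (\<lambda>h. h * D)) F"
proof -
  have "(*) D = (\<lambda>h. h * D)" by (rule ext) (rule mult.commute)
  then show ?thesis unfolding has_field_derivative_def by simp
qed

lemma has_derivative_along_path:
  assumes "(w has_derivative w') (at (X t, Y t))"
    and "(X has_real_derivative x) (at t)" "(Y has_real_derivative y) (at t)"
  shows "((\<lambda>t. w (X t, Y t)) has_real_derivative (x * w' (1, 0) + y * w' (0, 1))) (at t)"
proof -
  have "((\<lambda>t. (X t, Y t)) has_derivative (\<lambda>h. (h * x, h * y))) (at t)"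
    using assms(2,3) by (intro has_derivative_Pair) (simp_all add: has_real_derivative_iff_mult)
  from has_derivative_compose[OF this assms(1)]
  have "((\<lambda>t. w (X t, Y t)) has_derivative (\<lambda>h. w' (h * x, h * y))) (at t)" .
  moreover have "w' (h * x, h * y) = (x * w' (1, 0) + y * w' (0, 1)) * h" for h
  proof -
    have lin: "linear w'" using assms(1) has_derivative_linear by blast
    have "(h * x, h * y) = (h * x) *\<^sub>R (1, 0) + (h * y) *\<^sub>R (0, 1)" by simp
    then have "w' (h * x, h * y) = (h * x) * w' (1, 0) + (h * y) * w' (0, 1)"
      by (simp only: linear_add[OF lin] linear_scale[OF lin] real_scaleR_def)
    then show ?thesis by (simp add: algebra_simps)
  qed
  ultimately show ?thesis by (simp only: has_field_derivative_def)
qed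

lemma differentiable_along_path:
  assumes "w differentiable (at (X t, Y t))"
    and "(X has_real_derivative x) (at t)" "(Y has_real_derivative y) (at t)"
  shows "((\<lambda>t. w (X t, Y t)) has_real_derivative
    (x * partial_deriv (1, 0) w (X t, Y t) + y * partial_deriv (0, 1) w (X t, Y t))) (at t)"
  unfolding partial_deriv_def
  using has_derivative_along_path[OF _ assms(2,3)] assms(1) frechet_derivative_works by blast

lemma C2_on_differentiable:
  fixes u :: "real \<times> real \<Rightarrow> real"
  assumes "C2_on \<Omega> u" "p \<in> \<Omega>"
  shows "u differentiable (at p)" "partial_deriv (1, 0) u differentiable (at p)"
    "partial_deriv (0, 1) u differentiable (at p)"
  using assms unfolding C2_on_def by (auto simp: Basis_prod_def)

lemma laplacian_prod:
  "laplacian u p = partial_deriv (1, 0) (partial_deriv (1, 0) u) p +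
     partial_deriv (0, 1) (partial_deriv (0, 1) u) (p :: real \<times> real)"
  unfolding laplacian_def by (simp add: Basis_prod_def)

lemma has_laplacian_C2:
  assumes "C2_on \<Omega> u" "open \<Omega>" "p \<in> \<Omega>"
  shows "has_laplacian u p (laplacian u p)"
proof -
  obtain x y where p: "p = (x, y)" by fastforce
  note diff = C2_on_differentiable[OF assms(1)]
  have path1: "((\<lambda>s. w (s, y)) has_real_derivative partial_deriv (1, 0) w (t, y)) (at t)"
    if "w differentiable (at (t, y))" for w t
    using differentiable_along_path[of w "\<lambda>s. s" t "\<lambda>s. y" 1 0] that by simp
  have path2: "((\<lambda>s. w (x, s)) has_real_derivative partial_deriv (0, 1) w (x, t)) (at t)"
    if "w differentiable (at (x, t))" for w t
    using differentiable_along_path[of w "\<lambda>s. x" t "\<lambda>s. s" 0 1] that by simp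
  have "second_deriv (\<lambda>s. u (s, y)) x (partial_deriv (1, 0) (partial_deriv (1, 0) u) (x, y))"
  proof (rule second_derivI[where h' = "\<lambda>s. partial_deriv (1, 0) u (s, y)"])
    show "open ((\<lambda>s. (s, y)) -` \<Omega>)" by (intro open_vimage assms continuous_intros)
  qed (use assms(3) p in \<open>simp_all add: path1 diff\<close>)
  moreover have "second_deriv (\<lambda>s. u (x, s)) y (partial_deriv (0, 1) (partial_deriv (0, 1) u) (x, y))"
  proof (rule second_derivI[where h' = "\<lambda>s. partial_deriv (0, 1) u (x, s)"])
    show "open ((\<lambda>s. (x, s)) -` \<Omega>)" by (intro open_vimage assms continuous_intros)
  qed (use assms(3) p in \<open>simp_all add: path2 diff\<close>)
  ultimately show ?thesis
    unfolding has_laplacian_def laplacian_prod p fst_conv snd_conv by blast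
qed

text \<open>Logarithmic polar coordinates about \<open>z\<close>, with the first coordinate decreasing in the radius:
  inversions in circles about \<open>z\<close> become reflections in vertical lines.\<close>

definition log_polar :: "real \<times> real \<Rightarrow> real \<times> real \<Rightarrow> real \<times> real" where
  "log_polar z q = (fst z + exp (- fst q) * cos (snd q), snd z + exp (- fst q) * sin (snd q))"

lemma continuous_on_log_polar: "continuous_on S (log_polar z)"
  unfolding log_polar_def by (intro continuous_intros)

lemma log_polar_differentiable: "log_polar z differentiable (at q)"
proof -
  have "((\<lambda>q. (fst z + exp (- fst q) * cos (snd q), snd z + exp (- fst q) * sin (snd q))) has_derivative
    (\<lambda>h. (- fst h * exp (- fst q) * cos (snd q) - exp (- fst q) * sin (snd q) * snd h,
           - fst h * exp (- fst q) * sin (snd q) + exp (- fst q) * cos (snd q) * snd h))) (at q)"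
    by (rule has_derivative_Pair; (rule derivative_eq_intros refl)+; simp add: algebra_simps)
  then show ?thesis unfolding log_polar_def differentiable_def by blast
qed

lemma polar_norm: "(exp a * cos b)\<^sup>2 + (exp a * sin b)\<^sup>2 = (exp (a :: real))\<^sup>2"
proof -
  have "(exp a * cos b)\<^sup>2 + (exp a * sin b)\<^sup>2 = (exp a)\<^sup>2 * ((cos b)\<^sup>2 + (sin b)\<^sup>2)"
    by (simp only: power_mult_distrib distrib_left)
  then show ?thesis by simp
qed

lemma dist_log_polar: "dist (log_polar z q) z = exp (- fst q)"
  using polar_norm[of "- fst q" "snd q"] by (cases z) (simp add: log_polar_def dist_prod_def dist_real_def)

lemma log_polar_exists:
  assumes "p \<noteq> z"
  obtains \<theta> where "p = log_polar z (- ln (dist p z), \<theta>)"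
proof -
  define \<rho> where "\<rho> = dist p z"
  have "0 < \<rho>" using assms by (simp add: \<rho>_def)
  have "\<rho>\<^sup>2 = (fst p - fst z)\<^sup>2 + (snd p - snd z)\<^sup>2"
    by (simp add: \<rho>_def dist_prod_def dist_real_def)
  then have "((fst p - fst z) / \<rho>)\<^sup>2 + ((snd p - snd z) / \<rho>)\<^sup>2 = \<rho>\<^sup>2 / \<rho>\<^sup>2"
    by (simp only: power_divide add_divide_distrib[symmetric])
  then have "((fst p - fst z) / \<rho>)\<^sup>2 + ((snd p - snd z) / \<rho>)\<^sup>2 = 1"
    using \<open>0 < \<rho>\<close> by simp
  then obtain \<theta> where "(fst p - fst z) / \<rho> = cos \<theta>" "(snd p - snd z) / \<rho> = sin \<theta>"
    using sincos_total_2pi by metis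
  then have "fst p = fst z + \<rho> * cos \<theta>" "snd p = snd z + \<rho> * sin \<theta>"
    using \<open>0 < \<rho>\<close> by (auto simp: field_simps)
  then have "p = log_polar z (- ln \<rho>, \<theta>)"
    unfolding log_polar_def using \<open>0 < \<rho>\<close> by (intro prod_eqI) simp_all
  then show thesis unfolding \<rho>_def by (rule that)
qed

text \<open>The map is conformal (orientation reversing) with scale factor
  \<open>exp (- fst q)\<close>, so the Laplacian is multiplied by the square of that factor. Its
  components are harmonic in the new coordinates, hence the first-order terms cancel;
  \<open>uxy\<close> and \<open>uyx\<close> are kept apart and each cancels on its own.\<close>

lemma has_laplacian_log_polar:
  assumes "C2_on \<Omega> u" "open \<Omega>" "log_polar z q \<in> \<Omega>"
  shows "has_laplacian (\<lambda>q. u (log_polar z q)) q (exp (- 2 * fst q) * laplacian u (log_polar z q))"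
proof -
  obtain t \<theta> where q: "q = (t, \<theta>)" by fastforce
  define X where "X t \<theta> = fst z + exp (- t) * cos \<theta>" for t \<theta>
  define Y where "Y t \<theta> = snd z + exp (- t) * sin \<theta>" for t \<theta>
  have lp: "log_polar z (t, \<theta>) = (X t \<theta>, Y t \<theta>)" for t \<theta> by (simp add: log_polar_def X_def Y_def)
  have dX: "((\<lambda>t. X t \<theta>) has_real_derivative - exp (- t) * cos \<theta>) (at t)"
    "((\<lambda>\<theta>. X t \<theta>) has_real_derivative - exp (- t) * sin \<theta>) (at \<theta>)"
    and dY: "((\<lambda>t. Y t \<theta>) has_real_derivative - exp (- t) * sin \<theta>) (at t)"
    "((\<lambda>\<theta>. Y t \<theta>) has_real_derivative exp (- t) * cos \<theta>) (at \<theta>)" for t \<theta>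
    unfolding X_def Y_def by (auto intro!: derivative_eq_intros)
  note path_t = differentiable_along_path[where X = "\<lambda>t. X t \<theta>" and Y = "\<lambda>t. Y t \<theta>", OF _ dX(1) dY(1)]
    and path_\<theta> = differentiable_along_path[where X = "X t" and Y = "Y t", OF _ dX(2) dY(2)]
  define ux where "ux = partial_deriv (1, 0) u"
  define uy where "uy = partial_deriv (0, 1) u"
  define P where "P = (X t \<theta>, Y t \<theta>)"
  define uxx where "uxx = partial_deriv (1, 0) ux P"
  define uxy where "uxy = partial_deriv (0, 1) ux P"
  define uyx where "uyx = partial_deriv (1, 0) uy P"
  define uyy where "uyy = partial_deriv (0, 1) uy P"
  have P: "P \<in> \<Omega>" using assms(3) by (simp add: q lp P_def)
  note diff = C2_on_differentiable[OF assms(1), folded ux_def uy_def]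
  \<comment> \<open>(\<open>c\<close>, \<open>s\<close>) is the offset of the point from
    \<open>z\<close>; the derivatives of (X, Y) are (-c, -s) in \<open>t\<close> and (-s, c) in
    \<open>\<theta>\<close>.\<close>
  define c where "c = exp (- t) * cos \<theta>"
  define s where "s = exp (- t) * sin \<theta>"
  have open_t: "open {r. (X r \<theta>, Y r \<theta>) \<in> \<Omega>}" and open_\<theta>: "open {r. (X t r, Y t r) \<in> \<Omega>}"
    unfolding X_def Y_def
    using open_vimage[OF assms(2), of "\<lambda>r. (fst z + exp (- r) * cos \<theta>, snd z + exp (- r) * sin \<theta>)"]
      open_vimage[OF assms(2), of "\<lambda>r. (fst z + exp (- t) * cos r, snd z + exp (- t) * sin r)"]
    by (simp_all add: vimage_def continuous_intros)
  have st: "second_deriv (\<lambda>r. u (X r \<theta>, Y r \<theta>)) t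
      (c * ux P + s * uy P + c * (c * uxx + s * uxy) + s * (c * uyx + s * uyy))"
  proof (rule second_derivI[OF open_t])
    show "t \<in> {r. (X r \<theta>, Y r \<theta>) \<in> \<Omega>}" using P by (simp add: P_def)
    show "((\<lambda>r. u (X r \<theta>, Y r \<theta>)) has_real_derivative
        (- exp (- r) * cos \<theta> * ux (X r \<theta>, Y r \<theta>) + - exp (- r) * sin \<theta> * uy (X r \<theta>, Y r \<theta>))) (at r)"
      if "r \<in> {r. (X r \<theta>, Y r \<theta>) \<in> \<Omega>}" for r
      unfolding ux_def uy_def using that by (intro path_t diff(1)) simp
    have "((\<lambda>r. ux (X r \<theta>, Y r \<theta>)) has_real_derivative (- exp (- t) * cos \<theta> * uxx + - exp (- t) * sin \<theta> * uxy)) (at t)"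
      "((\<lambda>r. uy (X r \<theta>, Y r \<theta>)) has_real_derivative (- exp (- t) * cos \<theta> * uyx + - exp (- t) * sin \<theta> * uyy)) (at t)"
      unfolding uxx_def uxy_def uyx_def uyy_def P_def
      by (rule path_t; use P in \<open>simp add: P_def diff\<close>)+
    note d = this
    show "((\<lambda>r. - exp (- r) * cos \<theta> * ux (X r \<theta>, Y r \<theta>) + - exp (- r) * sin \<theta> * uy (X r \<theta>, Y r \<theta>))
      has_real_derivative c * ux P + s * uy P + c * (c * uxx + s * uxy) + s * (c * uyx + s * uyy)) (at t)"
    proof (rule DERIV_cong[OF DERIV_add[OF DERIV_mult[OF _ d(1)] DERIV_mult[OF _ d(2)]]])
      show "((\<lambda>r. - exp (- r) * cos \<theta>) has_real_derivative c) (at t)"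
        "((\<lambda>r. - exp (- r) * sin \<theta>) has_real_derivative s) (at t)"
        unfolding c_def s_def by (auto intro!: derivative_eq_intros)
    qed (simp add: c_def s_def P_def algebra_simps)
  qed
  have s\<theta>: "second_deriv (\<lambda>r. u (X t r, Y t r)) \<theta>
      (- c * ux P - s * uy P - s * (- s * uxx + c * uxy) + c * (- s * uyx + c * uyy))"
  proof (rule second_derivI[OF open_\<theta>])
    show "\<theta> \<in> {r. (X t r, Y t r) \<in> \<Omega>}" using P by (simp add: P_def)
    show "((\<lambda>r. u (X t r, Y t r)) has_real_derivative
        (- exp (- t) * sin r * ux (X t r, Y t r) + exp (- t) * cos r * uy (X t r, Y t r))) (at r)"
      if "r \<in> {r. (X t r, Y t r) \<in> \<Omega>}" for r
      unfolding ux_def uy_def using that by (intro path_\<theta> diff(1)) simp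
    have "((\<lambda>r. ux (X t r, Y t r)) has_real_derivative (- exp (- t) * sin \<theta> * uxx + exp (- t) * cos \<theta> * uxy)) (at \<theta>)"
      "((\<lambda>r. uy (X t r, Y t r)) has_real_derivative (- exp (- t) * sin \<theta> * uyx + exp (- t) * cos \<theta> * uyy)) (at \<theta>)"
      unfolding uxx_def uxy_def uyx_def uyy_def P_def
      by (rule path_\<theta>; use P in \<open>simp add: P_def diff\<close>)+
    note d = this
    show "((\<lambda>r. - exp (- t) * sin r * ux (X t r, Y t r) + exp (- t) * cos r * uy (X t r, Y t r))
      has_real_derivative (- c * ux P - s * uy P - s * (- s * uxx + c * uxy) + c * (- s * uyx + c * uyy))) (at \<theta>)"
    proof (rule DERIV_cong[OF DERIV_add[OF DERIV_mult[OF _ d(1)] DERIV_mult[OF _ d(2)]]])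
      show "((\<lambda>r. - exp (- t) * sin r) has_real_derivative - c) (at \<theta>)"
        "((\<lambda>r. exp (- t) * cos r) has_real_derivative - s) (at \<theta>)"
        unfolding c_def s_def by (auto intro!: derivative_eq_intros)
    qed (simp add: c_def s_def P_def algebra_simps)
  qed
  have cs: "c\<^sup>2 + s\<^sup>2 = exp (- 2 * t)"
    unfolding c_def s_def polar_norm using exp_double[of "- t"] by simp
  have "exp (- 2 * t) * laplacian u P =
      (c * ux P + s * uy P + c * (c * uxx + s * uxy) + s * (c * uyx + s * uyy)) +
      (- c * ux P - s * uy P - s * (- s * uxx + c * uxy) + c * (- s * uyx + c * uyy))"
    unfolding laplacian_prod cs[symmetric] ux_def[symmetric] uy_def[symmetric]
      uxx_def[symmetric] uyy_def[symmetric]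
    by (simp add: algebra_simps power2_eq_square)
  then show ?thesis
    unfolding has_laplacian_def q lp fst_conv snd_conv P_def[symmetric] using st s\<theta> by blast
qed

subsection \<open>Positive solutions outside a disc\<close>

text \<open>Those properties of a solution that pass easily through a linear reflection:
  \<open>has_laplacian\<close> stands in for \<open>C2_on\<close> and \<open>laplacian\<close>,
  whose iterated Frechet derivatives are awkward to transport. Positivity is included so that it is
  proved once.\<close>

definition solves :: "(real \<times> real) set \<Rightarrow> (real \<Rightarrow> real) \<Rightarrow> (real \<times> real \<Rightarrow> real) \<Rightarrow> bool" where
  "solves \<Omega> f u \<longleftrightarrow> open \<Omega> \<and> bounded \<Omega> \<and> continuous_on (closure \<Omega>) u \<and> (\<forall>p\<in>frontier \<Omega>. u p = 0) \<and>
     (\<forall>p\<in>\<Omega>. 0 < u p \<and> u differentiable (at p) \<and> has_laplacian u p (- f (u p)))"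

text \<open>Since f \<ge> 0, \<open>u\<close> is superharmonic. Being non-constant, it stays
  strictly above its minimum in the domain, so the minimum is attained on the boundary and equals
  0.\<close>

lemma positive_solution:
  assumes "\<And>s. 0 \<le> f s" and sol: "classical_solution \<Omega> f u" and nonconst: "\<not> u constant_on \<Omega>"
    and "open \<Omega>" "connected \<Omega>" "bounded \<Omega>"
  shows "solves \<Omega> f u"
proof -
  have C2: "C2_on \<Omega> u" and cont: "continuous_on (closure \<Omega>) u"
    and eq: "\<And>p. p \<in> \<Omega> \<Longrightarrow> laplacian u p + f (u p) = 0" and zero: "\<And>p. p \<in> frontier \<Omega> \<Longrightarrow> u p = 0"
    using sol unfolding classical_solution_def by auto
  have lap: "has_laplacian u p (- f (u p))" if "p \<in> \<Omega>" for p
  proof -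
    have "laplacian u p = - f (u p)" using eq[OF that] by simp
    then show ?thesis using has_laplacian_C2[OF C2 \<open>open \<Omega>\<close> that] by simp
  qed
  have diff: "u differentiable (at p)" if "p \<in> \<Omega>" for p
    using C2_on_differentiable(1)[OF C2 that] .
  have "\<Omega> \<noteq> {}" using nonconst by (auto simp: constant_on_def)
  then have "closure \<Omega> \<noteq> {}" by simp
  moreover have "compact (closure \<Omega>)" using \<open>bounded \<Omega>\<close> by (simp add: compact_closure)
  ultimately obtain p0 where p0: "p0 \<in> closure \<Omega>" "\<And>p. p \<in> closure \<Omega> \<Longrightarrow> u p0 \<le> u p"
    using continuous_attains_inf[OF _ _ cont] by blast
  have ge: "u p0 \<le> u p" if "p \<in> \<Omega>" for p using p0(2)[of p] that closure_subset by blast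
  obtain q0 where q0: "q0 \<in> \<Omega>" "u p0 < u q0"
    using nonconst ge unfolding constant_on_def by (metis order_le_less)
  have gt: "u p0 < u p" if "p \<in> \<Omega>" for p
  proof -
    have "0 < u p - u p0"
    proof (rule strong_maximum_principle[where D = \<Omega> and M = 0 and w = "\<lambda>p. u p - u p0"])
      fix q assume q: "q \<in> \<Omega>"
      show "(\<lambda>p. u p - u p0) differentiable (at q)"
        using diff[OF q] by (intro derivative_intros)
      have "second_deriv (\<lambda>_. c) x 0" for c x
        by (rule second_derivI[where S = UNIV and h' = "\<lambda>_. 0"]) (auto intro!: derivative_eq_intros)
      then have "has_laplacian (\<lambda>_. u p0) q 0"
        unfolding has_laplacian_def by force
      from has_laplacian_diff[OF lap[OF q] this]
      show "\<exists>L. has_laplacian (\<lambda>p. u p - u p0) q L \<and> L \<le> 0 * (u q - u p0)"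
        using assms(1)[of "u q"] by auto
    qed (use that q0 ge \<open>open \<Omega>\<close> \<open>connected \<Omega>\<close> in auto)
    then show ?thesis by simp
  qed
  then have "p0 \<notin> \<Omega>" by blast
  then have "p0 \<in> frontier \<Omega>" using p0(1) \<open>open \<Omega>\<close> by (simp add: frontier_def interior_open)
  then have "u p0 = 0" by (rule zero)
  then show ?thesis
    unfolding solves_def using gt diff lap cont zero \<open>open \<Omega>\<close> \<open>bounded \<Omega>\<close> by auto
qed

section \<open>Transport of solutions and critical points under reflections\<close>

lemma solves_transfer:
  assumes "solves \<Omega> f u" "linear T" and inv: "\<And>p. T (T p) = p"
    and lap: "\<And>p L. has_laplacian u (T p) L \<Longrightarrow> has_laplacian (u \<circ> T) p L"
  shows "solves (T -` \<Omega>) f (u \<circ> T)"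
proof -
  have T: "continuous_on S T" "T differentiable (at p)" for S p
    using \<open>linear T\<close> by (simp_all add: linear_continuous_on linear_conv_bounded_linear linear_imp_differentiable)
  have "inj T" using inv by (metis injI)
  \<comment> \<open>For an involution preimages are images, so the facts about closures and
    boundedness of linear images apply.\<close>
  have vim: "T -` S = T ` S" for S
    using inv by (auto simp: image_iff) (metis inv)
  have cl: "closure (T -` \<Omega>) = T -` closure \<Omega>"
    unfolding vim using closure_injective_linear_image[OF \<open>linear T\<close> \<open>inj T\<close>] by metis
  have "open (T -` \<Omega>)"
    using assms(1) T by (auto simp: solves_def intro: open_vimage)
  have "bounded (T -` \<Omega>)"
    unfolding vim using assms \<open>linear T\<close>
    by (auto simp: solves_def linear_conv_bounded_linear intro: bounded_linear_image)
  have front: "T p \<in> frontier \<Omega>" if "p \<in> frontier (T -` \<Omega>)" for p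
    using that assms(1) \<open>open (T -` \<Omega>)\<close> by (auto simp: frontier_def cl interior_open solves_def)
  have "continuous_on (T -` closure \<Omega>) (u \<circ> T)"
    using assms(1) T by (intro continuous_on_compose) (auto simp: solves_def vim inv image_image)
  moreover have "(u \<circ> T) differentiable (at p)" if "T p \<in> \<Omega>" for p
    using assms(1) that T by (intro differentiable_chain_at) (auto simp: solves_def)
  ultimately show ?thesis
    using assms(1) \<open>open (T -` \<Omega>)\<close> \<open>bounded (T -` \<Omega>)\<close> front lap
    unfolding solves_def cl by auto
qed

lemma linear_reflections:
  "linear (\<lambda>q :: real \<times> real. (- fst q, snd q))" "linear (\<lambda>q :: real \<times> real. (snd q, fst q))"
  by (auto intro!: linearI)

lemma solves_negate:
  assumes "solves \<Omega> f u"
  shows "solves ((\<lambda>q. (- fst q, snd q)) -` \<Omega>) f (u \<circ> (\<lambda>q. (- fst q, snd q)))"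
  using assms linear_reflections(1)
proof (rule solves_transfer)
  show "has_laplacian (u \<circ> (\<lambda>q. (- fst q, snd q))) p L" if "has_laplacian u (- fst p, snd p) L" for p L
    using has_laplacian_reflect[of u 0 p L] that by (simp add: o_def)
qed auto

lemma solves_swap:
  assumes "solves \<Omega> f u"
  shows "solves ((\<lambda>q. (snd q, fst q)) -` \<Omega>) f (u \<circ> (\<lambda>q. (snd q, fst q)))"
  using assms linear_reflections(2)
proof (rule solves_transfer)
  show "has_laplacian (u \<circ> (\<lambda>q. (snd q, fst q))) p L" if "has_laplacian u (snd p, fst p) L" for p L
    using has_laplacian_swap[of u p L] that by (simp add: o_def)
qed auto

lemma critical_transfer:
  assumes "(u has_derivative (\<lambda>_. 0)) (at (T p))" "linear T"
  shows "((u \<circ> T) has_derivative (\<lambda>_. 0)) (at (p :: real \<times> real))"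
proof -
  have "(T has_derivative T) (at p)"
    using assms(2) by (simp add: linear_imp_has_derivative)
  from diff_chain_at[OF this assms(1)] show ?thesis by (simp add: o_def)
qed

section \<open>Ellipses and the removal of a disc\<close>

lemma mem_ellipse: "p \<in> ellipse_interior b1 b2 \<longleftrightarrow> (fst p / b1)\<^sup>2 + (snd p / b2)\<^sup>2 < 1"
  unfolding ellipse_interior_def by (cases p) auto

lemma ellipse_vimage: "ellipse_interior b1 b2 = (\<lambda>p. (fst p / b1, snd p / b2)) -` ball 0 1"
  by (auto simp: mem_ellipse norm_prod_def power_divide)

lemma open_ellipse: "open (ellipse_interior b1 b2)"
  unfolding ellipse_vimage by (intro open_vimage open_ball) (simp add: divide_inverse continuous_intros)

lemma convex_ellipse: "convex (ellipse_interior b1 b2)"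
  unfolding ellipse_vimage
  by (intro convex_linear_vimage convex_ball linearI) (auto simp: add_divide_distrib)

lemma ellipse_bounds:
  assumes "p \<in> ellipse_interior b1 b2" "0 < b1" "0 < b2"
  shows "\<bar>fst p\<bar> < b1" "\<bar>snd p\<bar> < b2"
proof -
  have "(fst p / b1)\<^sup>2 < 1" "(snd p / b2)\<^sup>2 < 1"
    using assms(1) zero_le_power2[of "fst p / b1"] zero_le_power2[of "snd p / b2"] unfolding mem_ellipse
    by linarith+
  then show "\<bar>fst p\<bar> < b1" "\<bar>snd p\<bar> < b2"
    using assms by (simp_all add: abs_square_less_1)
qed

lemma bounded_ellipse:
  assumes "0 < b1" "0 < b2"
  shows "bounded (ellipse_interior b1 b2)"
proof -
  have "ellipse_interior b1 b2 \<subseteq> {-b1..b1} \<times> {-b2..b2}"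
  proof
    fix q assume "q \<in> ellipse_interior b1 b2"
    from ellipse_bounds[OF this assms] show "q \<in> {-b1..b1} \<times> {-b2..b2}"
      by (simp add: mem_Times_iff abs_less_iff)
  qed
  then show ?thesis
    by (rule bounded_subset[rotated]) (simp add: bounded_Times)
qed

lemma ellipse_circle:
  assumes "0 < R"
  shows "ellipse_interior R R = ball (0, 0) R"
proof -
  have "(x / R)\<^sup>2 + (y / R)\<^sup>2 < 1 \<longleftrightarrow> sqrt (x\<^sup>2 + y\<^sup>2) < R" for x y
  proof -
    have "(x / R)\<^sup>2 + (y / R)\<^sup>2 < 1 \<longleftrightarrow> x\<^sup>2 + y\<^sup>2 < R\<^sup>2"
      using assms by (simp add: power_divide flip: add_divide_distrib)
    also have "\<dots> \<longleftrightarrow> sqrt (x\<^sup>2 + y\<^sup>2) < sqrt (R\<^sup>2)" by (rule real_sqrt_less_iff[symmetric])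
    finally show ?thesis using assms by simp
  qed
  then show ?thesis by (auto simp: mem_ellipse dist_prod_def dist_real_def)
qed

text \<open>Reduces to removing open balls whose closure lies in \<open>S\<close>: the removal of
  \<open>cball z r\<close> is the union of the removals of \<open>ball z s\<close> for r < s < m,
  and all of these share the point \<open>q\<close>.\<close>

lemma connected_diff_cball:
  fixes S :: "'a :: euclidean_space set"
  assumes "connected S" "ball z m \<subseteq> S" "r < m" "q \<in> S" "dist z q = m" "2 \<le> DIM('a)"
  shows "connected (S - cball z r)"
proof -
  have "S - cball z r = (\<Union>s\<in>{r<..<m}. S - ball z s)"
  proof (intro equalityI subsetI)
    fix x assume "x \<in> S - cball z r"
    then show "x \<in> (\<Union>s\<in>{r<..<m}. S - ball z s)"
      using \<open>r < m\<close> by (intro UN_I[of "min ((r + m) / 2) (dist z x)"]) (auto simp: min_less_iff_disj)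
  qed auto
  also have "connected \<dots>"
  proof (rule connected_Union)
    fix T assume "T \<in> (\<lambda>s. S - ball z s) ` {r<..<m}"
    then obtain s where "s < m" "T = S - ball z s" by auto
    then show "connected T"
      using assms by (auto intro!: connected_diff_ball subset_trans[OF _ assms(2)] simp: cball_subset_ball_iff)
  next
    have "q \<in> \<Inter> ((\<lambda>s. S - ball z s) ` {r<..<m})" using assms by auto
    then show "\<Inter> ((\<lambda>s. S - ball z s) ` {r<..<m}) \<noteq> {}" by blast
  qed
  finally show ?thesis .
qed

text \<open>The line at (c + r + b1) / 2 mirrors the tip b1 of the ellipse to c + r, the rightmost
  abscissa of the hole. Up to this position images of cap points stay to the right of the hole; they
  stay in the ellipse because mirroring in a line at positive abscissa brings them closer to the
  vertical axis.\<close>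

lemma critical_point_right:
  assumes sol: "solves \<Omega> f u" and f: "\<And>s. 0 \<le> f s" "locally_lipschitz f"
    and \<Omega>: "\<Omega> = ellipse_interior b1 b2 - cball (c, 0) r"
    and b: "0 < b1" "0 < b2" and c: "c + r < b1" "0 < c + r + b1"
    and p: "p \<in> \<Omega>" "(u has_derivative (\<lambda>_. 0)) (at p)"
  shows "fst p < (c + r + b1) / 2"
proof (rule ccontr)
  define lam0 where "lam0 = (c + r + b1) / 2"
  assume "\<not> fst p < (c + r + b1) / 2"
  then have "lam0 \<le> fst p" by (simp add: lam0_def)
  have lam0: "0 < lam0" "c + r < lam0" using c by (simp_all add: lam0_def)
  have \<Omega>_iff: "q \<in> \<Omega>" if "q \<in> ellipse_interior b1 b2" "c + r < fst q" for q
  proof -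
    have "\<bar>c - fst q\<bar> \<le> dist (c, 0) q"
      using dist_fst_le[of "(c, 0)" q] by (simp add: dist_real_def)
    then show ?thesis using that by (auto simp: \<Omega>)
  qed
  have closure_le: "(fst q / b1)\<^sup>2 + (snd q / b2)\<^sup>2 \<le> 1" "fst q \<le> b1" if "q \<in> closure \<Omega>" for q
  proof -
    show "(fst q / b1)\<^sup>2 + (snd q / b2)\<^sup>2 \<le> 1"
    proof (rule continuous_le_on_closure[OF _ that])
      show "continuous_on (closure \<Omega>) (\<lambda>q. (fst q / b1)\<^sup>2 + (snd q / b2)\<^sup>2)"
        using b by (intro continuous_intros) auto
    qed (auto simp: \<Omega> mem_ellipse less_imp_le)
    show "fst q \<le> b1"
    proof (rule continuous_le_on_closure[OF _ that])
      show "continuous_on (closure \<Omega>) fst" by (intro continuous_intros)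
      show "fst q \<le> b1" if "q \<in> \<Omega>" for q
        using ellipse_bounds(1)[of q b1 b2] that b by (auto simp: \<Omega>)
    qed
  qed
  have mirror: "mirror lam q \<in> \<Omega>"
    if "(fst q / b1)\<^sup>2 + (snd q / b2)\<^sup>2 \<le> 1" "lam0 \<le> lam" "lam < fst q" "2 * lam - fst q > c + r" for q lam
  proof (rule \<Omega>_iff)
    have "(2 * lam - fst q)\<^sup>2 < (fst q)\<^sup>2"
      using that lam0 by (intro power2_strict_mono) auto
    then have "((2 * lam - fst q) / b1)\<^sup>2 < (fst q / b1)\<^sup>2"
      using b by (simp add: power_divide divide_strict_right_mono)
    then show "mirror lam q \<in> ellipse_interior b1 b2"
      using that by (simp add: mirror_def mem_ellipse)
  qed (use that in \<open>simp add: mirror_def\<close>)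
  have comp: "compact (closure \<Omega>)" using sol by (simp add: solves_def compact_closure)
  then have comp_u: "compact (u ` closure \<Omega>)"
    using sol by (intro compact_continuous_image) (auto simp: solves_def)
  obtain L where L: "0 \<le> L"
    "\<forall>s\<in>u ` closure \<Omega>. \<forall>t\<in>u ` closure \<Omega>. \<bar>f s - f t\<bar> \<le> L * \<bar>s - t\<bar>"
    using locally_lipschitz_compact[OF f(2) comp_u] by auto
  interpret moving_plane \<Omega> u f "\<lambda>_. 1" lam0 b1 L 1 "snd ` closure \<Omega>"
  proof
    show "open \<Omega>" "continuous_on (closure \<Omega>) u" using sol by (auto simp: solves_def)
    show "u differentiable (at q)" "0 < u q" "has_laplacian u q (- (1 * f (u q)))" if "q \<in> \<Omega>" for q
      using sol that by (auto simp: solves_def)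
    show "u q = 0" if "q \<in> closure \<Omega>" "q \<notin> \<Omega>" for q
      using sol that by (auto simp: solves_def frontier_def interior_open)
    show *: "fst q < b1" if "q \<in> \<Omega>" for q
      using ellipse_bounds(1)[of q b1 b2] that b by (auto simp: \<Omega>)
    show "mirror lam q \<in> \<Omega>"
      if "q \<in> closure \<Omega>" "lam0 \<le> lam" "lam < fst q" "lam0 < lam \<or> q \<in> \<Omega>" for q lam
    proof (rule mirror)
      show "2 * lam - fst q > c + r"
        using that closure_le(2)[of q] *[of q] by (auto simp: lam0_def)
    qed (use that closure_le in auto)
    show "connected (\<Omega> \<inter> {q. lam < fst q})" if "lam0 \<le> lam" for lam
    proof -
      have "\<Omega> \<inter> {q. lam < fst q} = ellipse_interior b1 b2 \<inter> {q. inner (1, 0) q > lam}"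
        using \<Omega>_iff that lam0 by (auto simp: \<Omega>)
      also have "convex \<dots>" by (intro convex_Int convex_ellipse convex_halfspace_gt)
      finally show ?thesis by (rule convex_connected)
    qed
    show "\<exists>q\<in>closure \<Omega>. q \<notin> \<Omega> \<and> lam < fst q \<and> 0 < u (mirror lam q)" if "lam0 \<le> lam" "lam < b1" for lam
    proof -
      \<comment> \<open>A boundary point over the middle of the cap instead of the tip: at
        \<open>lam = lam0\<close> the tip is mirrored onto the hole, whereas x < b1 keeps the image
        strictly to its right.\<close>
      define x where "x = (lam + b1) / 2"
      have x: "lam < x" "x < b1" "0 < x" using that lam0 by (auto simp: x_def)
      define q where "q = (x, b2 * sqrt (1 - (x / b1)\<^sup>2))"
      have "(x / b1)\<^sup>2 < 1" using x b by (simp add: abs_square_less_1)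
      then have on: "(fst q / b1)\<^sup>2 + (snd q / b2)\<^sup>2 = 1"
        using b by (simp add: q_def)
      \<comment> \<open>\<open>q\<close> is approached by shrinking towards the centre of the
        ellipse; t > lam / x keeps the scaled points to the right of the line, hence off the
        hole.\<close>
      have "q \<in> closure \<Omega>"
      proof (rule Lim_in_closed_set[where F = "at_left 1"])
        show "((\<lambda>t. t *\<^sub>R q) \<longlongrightarrow> q) (at_left 1)"
        proof -
          have "((\<lambda>t. t *\<^sub>R q) \<longlongrightarrow> 1 *\<^sub>R q) (at_left 1)" by (intro tendsto_intros)
          then show ?thesis by simp
        qed
        have "\<forall>\<^sub>F t in at_left 1. t \<in> {lam / x<..<1}"
          using x by (intro eventually_at_left_real) auto
        then show "\<forall>\<^sub>F t in at_left 1. t *\<^sub>R q \<in> closure \<Omega>"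
        proof eventually_elim
          case (elim t)
          then have t: "lam < t * x" "0 < t" "t < 1"
            using x that lam0 less_trans[of 0 "lam / x" t] by (simp_all add: pos_divide_less_eq)
          have "(t * fst q / b1)\<^sup>2 + (t * snd q / b2)\<^sup>2 = t\<^sup>2 * ((fst q / b1)\<^sup>2 + (snd q / b2)\<^sup>2)"
            by (simp add: power_divide power_mult_distrib algebra_simps)
          also have "\<dots> < 1" using on t by (simp add: abs_square_less_1)
          finally have "t *\<^sub>R q \<in> \<Omega>"
            using t that lam0 by (intro \<Omega>_iff) (auto simp: mem_ellipse q_def)
          then show ?case using closure_subset by blast
        qed
      qed auto
      moreover have "q \<notin> \<Omega>" using on by (auto simp: \<Omega> mem_ellipse)
      moreover have "mirror lam q \<in> \<Omega>"
        using on that x by (intro mirror) (auto simp: q_def lam0_def)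
      then have "0 < u (mirror lam q)" using sol by (auto simp: solves_def)
      ultimately show ?thesis using x by (intro bexI[of _ q]) (auto simp: q_def)
    qed
    show "compact (closure \<Omega> \<inter> UNIV \<times> snd ` closure \<Omega>)"
    proof -
      have "closure \<Omega> \<inter> UNIV \<times> snd ` closure \<Omega> = closure \<Omega>"
        by (intro Int_absorb2 subsetI) (simp add: mem_Times_iff)
      then show ?thesis using comp by simp
    qed
    show "\<exists>y\<in>snd ` closure \<Omega>. \<forall>x. ((x, y) \<in> closure \<Omega> \<longleftrightarrow> (x, snd q) \<in> closure \<Omega>) \<and> u (x, y) = u (x, snd q)"
      if "q \<in> closure \<Omega>" for q
      using that by (intro bexI[of _ "snd q"]) auto
    show "\<bar>f s - f t\<bar> \<le> L * \<bar>s - t\<bar>" if "s \<in> u ` closure \<Omega>" "t \<in> u ` closure \<Omega>" for s t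
      using L(2) that by blast
  qed (simp_all add: f L(1))
  have "(u has_derivative (\<lambda>_. 0)) (at (fst p, snd p))" using p(2) by simp
  from has_derivative_along_path[where X = "\<lambda>s. s" and Y = "\<lambda>s. snd p", OF this DERIV_ident DERIV_const]
  show False using fst_derivative_nonzero[OF p(1) \<open>lam0 \<le> fst p\<close>] by simp
qed

lemma critical_point_left:
  assumes sol: "solves \<Omega> f u" and f: "\<And>s. 0 \<le> f s" "locally_lipschitz f"
    and \<Omega>: "\<Omega> = ellipse_interior b1 b2 - cball (c, 0) r"
    and b: "0 < b1" "0 < b2" and c: "r - c < b1" "0 < r - c + b1"
    and p: "p \<in> \<Omega>" "(u has_derivative (\<lambda>_. 0)) (at p)"
  shows "- ((r - c + b1) / 2) < fst p"
proof -
  let ?T = "\<lambda>q :: real \<times> real. (- fst q, snd q)"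
  have "?T -` \<Omega> = ellipse_interior b1 b2 - cball (- c, 0) r"
  proof -
    have "dist (c, 0) (- x, y) = dist (- c, 0) (x, y)" for x y :: real
      by (simp add: dist_prod_def dist_real_def power2_eq_square algebra_simps)
    then show ?thesis by (auto simp: \<Omega> mem_ellipse)
  qed
  moreover have "((u \<circ> ?T) has_derivative (\<lambda>_. 0)) (at (?T p))"
    using p(2) by (intro critical_transfer linear_reflections) simp
  ultimately have "fst (?T p) < (- c + r + b1) / 2"
    using solves_negate[OF sol] f b c p(1) by (intro critical_point_right) auto
  then show ?thesis by (simp add: field_simps)
qed

text \<open>Exchanging the coordinates keeps a hole centred at the origin and swaps the semi-axes,
  so the horizontal bounds on both sides apply.\<close>

lemma critical_point_vertical:
  assumes sol: "solves \<Omega> f u" and f: "\<And>s. 0 \<le> f s" "locally_lipschitz f"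
    and \<Omega>: "\<Omega> = ellipse_interior b1 b2 - cball (0, 0) r"
    and b: "0 < b1" "0 < b2" and r: "0 < r" "r < b2"
    and p: "p \<in> \<Omega>" "(u has_derivative (\<lambda>_. 0)) (at p)"
  shows "\<bar>snd p\<bar> < (r + b2) / 2"
proof -
  let ?T = "\<lambda>q :: real \<times> real. (snd q, fst q)"
  have *: "?T -` \<Omega> = ellipse_interior b2 b1 - cball (0, 0) r"
    by (auto simp: \<Omega> mem_ellipse dist_prod_def add.commute)
  have d: "((u \<circ> ?T) has_derivative (\<lambda>_. 0)) (at (?T p))"
    using p(2) by (intro critical_transfer linear_reflections) simp
  have "fst (?T p) < (0 + r + b2) / 2"
    using solves_swap[OF sol] f * b r p(1) d by (intro critical_point_right) auto
  moreover have "- ((r - 0 + b2) / 2) < fst (?T p)"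
    using solves_swap[OF sol] f * b r p(1) d by (intro critical_point_left) auto
  ultimately show ?thesis by (simp add: abs_less_iff field_simps)
qed

text \<open>The caps are rings r < dist < sqrt (r s) with s \<le> m, which inversion maps into the
  annulus. At s = m the hole's circle is sent to the circle of radius m, which may meet the boundary
  of the domain, but passes through the point \<open>q\<close> of the domain.\<close>

lemma critical_point_inversion:
  assumes sol: "solves \<Omega> f u" and C2: "C2_on \<Omega> u" and eq: "\<And>p. p \<in> \<Omega> \<Longrightarrow> laplacian u p + f (u p) = 0"
    and f: "\<And>s. 0 \<le> f s" "locally_lipschitz f"
    and r: "0 < r" "r < m"
    and annulus: "ball z m - cball z r \<subseteq> \<Omega>" and hole: "\<Omega> \<inter> cball z r = {}"
    and asym: "q \<in> \<Omega>" "dist q z = m"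
    and p: "p \<in> \<Omega>" "(u has_derivative (\<lambda>_. 0)) (at p)"
  shows "sqrt (r * m) < dist p z"
proof (rule ccontr)
  assume "\<not> sqrt (r * m) < dist p z"
  then have le: "dist p z \<le> sqrt (r * m)" by simp
  define D where "D = {- ln m<..<- ln r} \<times> (UNIV :: real set)"
  define U where "U = (\<lambda>q. u (log_polar z q))"
  define lam0 where "lam0 = - (ln m + ln r) / 2"
  have "ln r < ln m" using r by simp
  have clD: "closure D = {- ln m..- ln r} \<times> UNIV"
    unfolding D_def closure_Times using \<open>ln r < ln m\<close> by simp
  have D_\<Omega>: "log_polar z q \<in> \<Omega>" if "q \<in> D" for q
  proof -
    have "ln r < - fst q" "- fst q < ln m" using that by (auto simp: D_def)
    then have "r < exp (- fst q)" "exp (- fst q) < m"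
      using exp_less_mono[of "ln r" "- fst q"] exp_less_mono[of "- fst q" "ln m"] r by simp_all
    then have "log_polar z q \<in> ball z m - cball z r"
      using dist_log_polar[of z q] by (simp add: dist_commute)
    then show ?thesis using annulus by blast
  qed
  have D_cl: "log_polar z ` closure D \<subseteq> closure \<Omega>"
    using D_\<Omega> closure_subset[of \<Omega>]
    by (intro image_closure_subset continuous_on_log_polar) auto
  have zero: "U q = 0" if "fst q = - ln r" for q
  proof -
    have "dist (log_polar z q) z = r" using dist_log_polar[of z q] that r by simp
    then have "log_polar z q \<notin> \<Omega>" using hole by (auto simp: dist_commute)
    moreover have "q \<in> closure D" using that \<open>ln r < ln m\<close> by (cases q) (simp add: clD)
    then have "log_polar z q \<in> closure \<Omega>" using D_cl by blast
    ultimately show ?thesis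
      using sol by (auto simp: solves_def U_def frontier_def interior_open)
  qed
  have "compact (closure \<Omega>)" using sol by (simp add: solves_def compact_closure)
  then have comp_u: "compact (u ` closure \<Omega>)"
    using sol by (intro compact_continuous_image) (auto simp: solves_def)
  obtain L where L: "0 \<le> L"
    "\<forall>s\<in>u ` closure \<Omega>. \<forall>t\<in>u ` closure \<Omega>. \<bar>f s - f t\<bar> \<le> L * \<bar>s - t\<bar>"
    using locally_lipschitz_compact[OF f(2) comp_u] by auto
  have "q \<noteq> z" using asym r by auto
  obtain \<theta>0 where \<theta>0: "q = log_polar z (- ln m, \<theta>0)"
    by (rule log_polar_exists[OF \<open>q \<noteq> z\<close>, unfolded asym(2)])
  \<comment> \<open>The right end \<open>- ln r\<close> is the circle of the hole, where
    \<open>u\<close> vanishes. The weight is the squared radius, hence at most m^2, and the last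
    argument is one period of the angle.\<close>
  interpret moving_plane D U f "\<lambda>t. exp (- 2 * t)" lam0 "- ln r" L "exp (2 * ln m)" "{0..2 * pi}"
  proof
    show "open D" unfolding D_def by (intro open_Times) auto
    show "continuous_on (closure D) U"
      unfolding U_def by (rule continuous_on_compose2[OF _ continuous_on_log_polar D_cl])
        (use sol in \<open>auto simp: solves_def\<close>)
    show "U differentiable (at q)" if "q \<in> D" for q
    proof -
      have "u differentiable (at (log_polar z q))" using sol D_\<Omega>[OF that] by (auto simp: solves_def)
      from differentiable_chain_at[OF log_polar_differentiable this]
      show ?thesis by (simp add: U_def o_def)
    qed
    show "has_laplacian U q (- (exp (- 2 * fst q) * f (U q)))" if "q \<in> D" for q
    proof -
      have "laplacian u (log_polar z q) = - f (U q)"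
        using eq[OF D_\<Omega>[OF that]] by (simp add: U_def)
      then show ?thesis
        using has_laplacian_log_polar[OF C2 _ D_\<Omega>[OF that]] sol by (simp add: U_def solves_def)
    qed
    show "0 < U q" if "q \<in> D" for q
      using sol D_\<Omega>[OF that] by (auto simp: solves_def U_def)
    \<comment> \<open>The opposite edge, at radius \<open>m\<close>, lies to the left of
      \<open>lam0\<close>; \<open>u\<close> may be positive there.\<close>
    show "U q = 0" if "q \<in> closure D" "q \<notin> D" "lam0 \<le> fst q" for q
    proof (rule zero)
      show "fst q = - ln r"
        using that(1)[unfolded clD] that(2,3) \<open>ln r < ln m\<close>
        by (cases q) (auto simp: D_def lam0_def)
    qed
    show "fst q < - ln r" if "q \<in> D" for q using that by (auto simp: D_def)
    show "mirror lam q \<in> D"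
      if "q \<in> closure D" "lam0 \<le> lam" "lam < fst q" "lam0 < lam \<or> q \<in> D" for q lam
      using that(1)[unfolded clD] that(2-4) by (cases q) (auto simp: D_def mirror_def lam0_def)
    show "connected (D \<inter> {q. lam < fst q})" for lam
    proof -
      have "D \<inter> {q. lam < fst q} = ({- ln m<..<- ln r} \<inter> {lam<..}) \<times> UNIV"
        by (auto simp: D_def)
      also have "convex \<dots>" by (intro convex_Times convex_Int) auto
      finally show ?thesis by (rule convex_connected)
    qed
    show "\<exists>q\<in>closure D. q \<notin> D \<and> lam < fst q \<and> 0 < U (mirror lam q)" if "lam0 \<le> lam" "lam < - ln r" for lam
    proof (intro bexI conjI)
      \<comment> \<open>The point of the hole's circle in the direction of \<open>q\<close>: at
        \<open>lam0\<close> its mirror image is \<open>q\<close> itself, and at every later position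
        the image is interior to the annulus.\<close>
      let ?q = "(- ln r, \<theta>0)"
      show "?q \<in> closure D" unfolding clD using \<open>ln r < ln m\<close> by simp
      show "?q \<notin> D" "lam < fst ?q" using that by (simp_all add: D_def)
      have "log_polar z (mirror lam ?q) \<in> \<Omega>"
      proof (cases "lam = lam0")
        case True
        then have "mirror lam ?q = (- ln m, \<theta>0)" by (simp add: mirror_def lam0_def)
        then show ?thesis using \<theta>0 asym by simp
      next
        case False
        then show ?thesis using that by (intro D_\<Omega>) (auto simp: mirror_def lam0_def D_def)
      qed
      then show "0 < U (mirror lam ?q)" using sol by (auto simp: solves_def U_def)
    qed
    show "\<bar>f s - f t\<bar> \<le> L * \<bar>s - t\<bar>" if "s \<in> U ` closure D" "t \<in> U ` closure D" for s t
    proof -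
      have "U ` closure D \<subseteq> u ` closure \<Omega>" using D_cl by (auto simp: U_def)
      then show ?thesis using L(2) that by blast
    qed
    show "exp (- 2 * fst q) \<le> exp (2 * ln m)" if "q \<in> D" for q using that by (auto simp: D_def)
    show "compact (closure D \<inter> UNIV \<times> {0..2 * pi})"
    proof -
      have "closure D \<inter> UNIV \<times> {0..2 * pi} = {- ln m..- ln r} \<times> {0..2 * pi}" by (auto simp: clD)
      then show ?thesis by (simp add: compact_Times)
    qed
    show "\<exists>y\<in>{0..2 * pi}. \<forall>x. ((x, y) \<in> closure D \<longleftrightarrow> (x, snd q) \<in> closure D) \<and> U (x, y) = U (x, snd q)" for q
    proof -
      obtain y where "0 \<le> y" "y < 2 * pi" "cos (snd q) = cos y" "sin (snd q) = sin y"
        by (rule sincos_total_2pi[OF sin_cos_squared_add2[of "snd q"]])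
      then show ?thesis by (intro bexI[of _ y]) (auto simp: clD U_def log_polar_def)
    qed
  qed (simp_all add: f L(1))
  have "r < dist p z" using p(1) hole by (force simp: dist_commute)
  then have "p \<noteq> z" using r by auto
  obtain \<theta> where \<theta>: "p = log_polar z (- ln (dist p z), \<theta>)"
    by (rule log_polar_exists[OF \<open>p \<noteq> z\<close>])
  define t where "t = - ln (dist p z)"
  have "ln (dist p z) \<le> ln (sqrt (r * m))" using le \<open>r < dist p z\<close> r by (intro ln_mono) auto
  also have "\<dots> = (ln r + ln m) / 2" using r by (simp add: ln_sqrt ln_mult)
  finally have "lam0 \<le> t" by (simp add: lam0_def t_def)
  have "t < - ln r" unfolding t_def using \<open>r < dist p z\<close> r by (simp add: ln_strict_mono)
  then have "(t, \<theta>) \<in> D" using \<open>lam0 \<le> t\<close> \<open>ln r < ln m\<close> by (simp add: D_def lam0_def)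
  have "((\<lambda>s. U (s, \<theta>)) has_real_derivative
      (- exp (- t) * cos \<theta> * 0 + - exp (- t) * sin \<theta> * 0)) (at t)"
    unfolding U_def log_polar_def fst_conv snd_conv
  proof (rule has_derivative_along_path[where w' = "\<lambda>_. 0"])
    show "(u has_derivative (\<lambda>_. 0)) (at (fst z + exp (- t) * cos \<theta>, snd z + exp (- t) * sin \<theta>))"
      using p(2) \<theta> by (simp add: log_polar_def t_def)
    show "((\<lambda>s. fst z + exp (- s) * cos \<theta>) has_real_derivative - exp (- t) * cos \<theta>) (at t)"
      "((\<lambda>s. snd z + exp (- s) * sin \<theta>) has_real_derivative - exp (- t) * sin \<theta>) (at t)"
      by (auto intro!: derivative_eq_intros)
  qed
  then show False using fst_derivative_nonzero[OF \<open>(t, \<theta>) \<in> D\<close>] \<open>lam0 \<le> t\<close> by simp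
qed

text \<open>A horizontal or vertical diameter of a contained disc is no longer than the
  corresponding axis. An upper bound is the useful direction, as the excluded ring grows with
  \<open>c\<close>.\<close>

lemma inradius_ellipse_le:
  assumes "0 < b1" "0 < b2"
  shows "inradius (ellipse_interior b1 b2) \<le> min b1 b2"
  unfolding inradius_def
proof (rule cSup_least)
  have "(0, 0) \<in> ellipse_interior b1 b2" by (simp add: mem_ellipse)
  then obtain e where "0 < e" "ball (0, 0) e \<subseteq> ellipse_interior b1 b2"
    by (rule openE[OF open_ellipse])
  then show "{\<rho>. 0 < \<rho> \<and> (\<exists>p. ball p \<rho> \<subseteq> ellipse_interior b1 b2)} \<noteq> {}" by auto
  fix \<rho> assume "\<rho> \<in> {\<rho>. 0 < \<rho> \<and> (\<exists>p. ball p \<rho> \<subseteq> ellipse_interior b1 b2)}"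
  then obtain p where \<rho>: "0 < \<rho>" and p: "ball p \<rho> \<subseteq> ellipse_interior b1 b2" by blast
  show "\<rho> \<le> min b1 b2"
  \<comment> \<open>The discs are open, so the extremal points are tested at every radius s <
    \<rho>.\<close>
  proof (rule dense_le_bounded[OF \<rho>])
    fix s assume s: "0 < s" "s < \<rho>"
    have "p + (s, 0) \<in> ball p \<rho>" "p - (s, 0) \<in> ball p \<rho>" "p + (0, s) \<in> ball p \<rho>" "p - (0, s) \<in> ball p \<rho>"
      using s by (auto simp: dist_norm norm_Pair)
    then have mem: "p + (s, 0) \<in> ellipse_interior b1 b2" "p - (s, 0) \<in> ellipse_interior b1 b2"
      "p + (0, s) \<in> ellipse_interior b1 b2" "p - (0, s) \<in> ellipse_interior b1 b2"
      using p by blast+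
    have "\<bar>fst p + s\<bar> < b1" "\<bar>fst p - s\<bar> < b1" "\<bar>snd p + s\<bar> < b2" "\<bar>snd p - s\<bar> < b2"
      using mem[THEN ellipse_bounds(1)[OF _ assms]] mem[THEN ellipse_bounds(2)[OF _ assms]] by simp_all
    then show "s \<le> min b1 b2" by (simp add: abs_less_iff)
  qed
qed

lemma ball_subset_ellipse:
  assumes "0 < m" "m \<le> b1" "m \<le> b2"
  shows "ball (0, 0) m \<subseteq> ellipse_interior b1 b2"
proof
  fix p :: "real \<times> real" assume "p \<in> ball (0, 0) m"
  then have "p \<in> ellipse_interior m m" using assms by (simp add: ellipse_circle)
  moreover have "(fst p / b1)\<^sup>2 \<le> (fst p / m)\<^sup>2" "(snd p / b2)\<^sup>2 \<le> (snd p / m)\<^sup>2"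
    using assms by (auto simp: power_divide intro!: divide_left_mono power_mono mult_pos_pos)
  ultimately show "p \<in> ellipse_interior b1 b2" by (simp add: mem_ellipse)
qed

lemma critical_point_derivative:
  assumes "p \<in> critical_points \<Omega> u"
  shows "p \<in> \<Omega>" "(u has_derivative (\<lambda>_. 0)) (at p)"
  using assms by (auto simp: critical_points_def gderiv_def)

theorem theoremD:
  fixes f :: "real \<Rightarrow> real" and u :: "real \<times> real \<Rightarrow> real" and \<Omega> :: "(real \<times> real) set"
  assumes "\<And>s. 0 \<le> f s"
    and "locally_lipschitz f"
    and "classical_solution \<Omega> f u"
    and "\<not> u constant_on \<Omega>"
  shows
    "(\<forall>a b1 b2 c. elliptic_exterior_petal_domain a b1 b2 \<Omega> \<and> c = inradius (ellipse_interior b1 b2) \<longrightarrow>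
        critical_points \<Omega> u \<subseteq>
          ({- ((a + b1) / 2)<..<(a + b1) / 2} \<times> {- ((a + b2) / 2)<..<(a + b2) / 2}) \<inter>
          (\<Omega> - {(x, y). a < sqrt (x\<^sup>2 + y\<^sup>2) \<and> sqrt (x\<^sup>2 + y\<^sup>2) \<le> sqrt (a * c)}))
     \<and>
     (\<forall>a r R. eccentric_annular_domain a r R \<Omega> \<longrightarrow>
        critical_points \<Omega> u \<subseteq>
          ({(- R + a - r) / 2<..<(a + r + R) / 2} \<times> {- R<..<R}) \<inter>
          (\<Omega> - {(x, y). r < sqrt ((x - a)\<^sup>2 + y\<^sup>2) \<and> sqrt ((x - a)\<^sup>2 + y\<^sup>2) \<le> sqrt (r * (R - a))}))"
proof -
  have C2: "C2_on \<Omega> u" and eq: "\<And>p. p \<in> \<Omega> \<Longrightarrow> laplacian u p + f (u p) = 0"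
    using assms(3) by (auto simp: classical_solution_def)
  note f = assms(1,2)
  \<comment> \<open>Serves both domains, the circle being an ellipse with equal semi-axes; the point
    \<open>q\<close> on the circle of radius \<open>m\<close> supplies the connectedness.\<close>
  have sol: "solves \<Omega> f u"
    if "\<Omega> = ellipse_interior b1 b2 - cball z r" "0 < b1" "0 < b2"
      "ball z m \<subseteq> ellipse_interior b1 b2" "r < m" "q \<in> ellipse_interior b1 b2" "dist q z = m"
    for b1 b2 z r m q
  proof (rule positive_solution)
    show "open \<Omega>" using that open_ellipse by (simp add: open_Diff)
    show "connected \<Omega>"
      unfolding that(1) using that(4-7)
      by (intro connected_diff_cball[of _ z m r q] convex_connected convex_ellipse) (auto simp: dist_commute)
    show "bounded \<Omega>" using that bounded_ellipse by (simp add: bounded_diff)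
  qed (use assms in auto)
  have ellipse: "p \<in> ({- ((a + b1) / 2)<..<(a + b1) / 2} \<times> {- ((a + b2) / 2)<..<(a + b2) / 2}) \<inter>
      (\<Omega> - {(x, y). a < sqrt (x\<^sup>2 + y\<^sup>2) \<and> sqrt (x\<^sup>2 + y\<^sup>2) \<le> sqrt (a * c)})"
    if dom: "elliptic_exterior_petal_domain a b1 b2 \<Omega>" and c: "c = inradius (ellipse_interior b1 b2)"
      and "p \<in> critical_points \<Omega> u" for a b1 b2 c p
  proof -
    note p = critical_point_derivative[OF that(3)]
    have b: "0 < a" "0 < b1" "0 < b2" "b1 \<noteq> b2" and sphere: "sphere (0, 0) a \<subseteq> ellipse_interior b1 b2"
      and \<Omega>: "\<Omega> = ellipse_interior b1 b2 - cball (0, 0) a"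
      using dom by (auto simp: elliptic_exterior_petal_domain_def)
    define m where "m = min b1 b2"
    have "(a, 0) \<in> ellipse_interior b1 b2" "(0, a) \<in> ellipse_interior b1 b2"
      using sphere b by (auto simp: dist_prod_def dist_real_def)
    then have a: "a < b1" "a < b2" using ellipse_bounds[OF _ b(2,3)] by force+
    then have m: "a < m" "0 < m" "m \<le> b1" "m \<le> b2" using b by (auto simp: m_def)
    have ball: "ball (0, 0) m \<subseteq> ellipse_interior b1 b2" using m by (intro ball_subset_ellipse)
    \<comment> \<open>At distance \<open>m\<close>, the shorter semi-axis, but along the longer
      axis: interior to the ellipse because b1 \<noteq> b2.\<close>
    define q where "q = (if b1 < b2 then (0, m) else (m, 0))"
    have q: "q \<in> ellipse_interior b1 b2" "dist q (0, 0) = m"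
      using b m by (auto simp: q_def mem_ellipse m_def abs_square_less_1 dist_prod_def dist_real_def)
    have s: "solves \<Omega> f u" by (rule sol[OF \<Omega> b(2,3) ball m(1) q])
    have "sqrt (a * m) < dist p (0, 0)"
    proof (rule critical_point_inversion[OF s C2 eq f b(1) m(1) _ _ _ _ p])
      show "q \<in> \<Omega>" "dist q (0, 0) = m" using q m by (auto simp: \<Omega> dist_commute)
    qed (use ball \<Omega> in auto)
    moreover have "sqrt (a * c) \<le> sqrt (a * m)"
      unfolding c m_def using b inradius_ellipse_le[OF b(2,3)] by (simp add: mult_left_mono)
    moreover have "dist p (0, 0) = sqrt ((fst p)\<^sup>2 + (snd p)\<^sup>2)"
      by (simp add: dist_prod_def dist_real_def)
    moreover have "fst p < (0 + a + b1) / 2"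
      by (rule critical_point_right[OF s f \<Omega> b(2,3) _ _ p]) (use a b in auto)
    moreover have "- ((a - 0 + b1) / 2) < fst p"
      by (rule critical_point_left[OF s f \<Omega> b(2,3) _ _ p]) (use a b in auto)
    moreover have "\<bar>snd p\<bar> < (a + b2) / 2"
      by (rule critical_point_vertical[OF s f \<Omega> b(2,3) b(1) a(2) p])
    ultimately show ?thesis using p(1) by (cases p) (auto simp: abs_less_iff field_simps)
  qed
  have eccentric: "p \<in> ({(- R + a - r) / 2<..<(a + r + R) / 2} \<times> {- R<..<R}) \<inter>
      (\<Omega> - {(x, y). r < sqrt ((x - a)\<^sup>2 + y\<^sup>2) \<and> sqrt ((x - a)\<^sup>2 + y\<^sup>2) \<le> sqrt (r * (R - a))})"
    if dom: "eccentric_annular_domain a r R \<Omega>" and "p \<in> critical_points \<Omega> u" for a r R p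
  proof -
    note p = critical_point_derivative[OF that(2)]
    have ar: "0 < a" "0 < r" "a + r < R" and "\<Omega> = ball (0, 0) R - cball (a, 0) r"
      using dom by (auto simp: eccentric_annular_domain_def)
    then have R: "0 < R" and \<Omega>: "\<Omega> = ellipse_interior R R - cball (a, 0) r"
      by (simp_all add: ellipse_circle)
    have ball: "ball (a, 0) (R - a) \<subseteq> ellipse_interior R R"
      unfolding ellipse_circle[OF R] using ar by (simp add: ball_subset_ball_iff dist_prod_def dist_real_def)
    \<comment> \<open>The circle of radius R - a about (a, 0) touches the outer circle at (R, 0);
      this is the antipode of that point, interior because 0 < a < R.\<close>
    have q: "(2 * a - R, 0) \<in> ellipse_interior R R" "dist (2 * a - R, 0 :: real) (a, 0) = R - a"
      using ar R by (auto simp: ellipse_circle dist_prod_def dist_real_def)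
    have s: "solves \<Omega> f u" by (rule sol[OF \<Omega> R R ball _ q]) (use ar in simp)
    have "sqrt (r * (R - a)) < dist p (a, 0)"
    proof (rule critical_point_inversion[OF s C2 eq f ar(2) _ _ _ _ _ p])
      show "(2 * a - R, 0) \<in> \<Omega>" "dist (2 * a - R, 0 :: real) (a, 0) = R - a"
        using q ar by (simp_all add: \<Omega> dist_commute[of "(a, 0)"])
    qed (use ball \<Omega> ar in auto)
    moreover have "dist p (a, 0) = sqrt ((fst p - a)\<^sup>2 + (snd p)\<^sup>2)"
      by (simp add: dist_prod_def dist_real_def)
    moreover have "fst p < (a + r + R) / 2"
      by (rule critical_point_right[OF s f \<Omega> R R _ _ p]) (use ar R in auto)
    moreover have "- ((r - a + R) / 2) < fst p"
      by (rule critical_point_left[OF s f \<Omega> R R _ _ p]) (use ar R in auto)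
    moreover have "\<bar>snd p\<bar> < R"
      using ellipse_bounds(2)[of p R R] p(1) \<Omega> R by simp
    ultimately show ?thesis using p(1) by (cases p) (auto simp: field_simps)
  qed
  show ?thesis using ellipse eccentric by blast
qed

end
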